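(* Let $v$ be an object of an indecomposable admissible component of the root groupoid, let $w\in W=W(v)$ and $v'=w(v)\in\mathrm{Sk}(v)$. Then the length $\ell(w)$ is the cardinality of the set $\Delta^+_{an}(v)\setminus\Delta^+_{an}(v')$.
   Context: Root groupoid. Fix a finite set $X$. A root datum is a quadruple $v=(\mathfrak h,a,b,p)$ with $\mathfrak h$ a finite-dimensional complex vector space, $a:X\to\mathfrak h$, $b:X\to\mathfrak h^*$ such that the families $(a(x))_{x\in X}$ and $(b(x))_{x\in X}$ are linearly independent, and $p:X\to\mathbb Z_2$; we write $\mathfrak h(v),a_v,b_v,p_v$. Its Cartan matrix is $a_{xy}=\langle a(x),b(y)\rangle$. An element $x\in X$ is reflectable at $v$ if: $a_{xx}=0$ implies $p(x)=1$; if $a_{xx}\ne 0$ and $p(x)=0$ then $2a_{xy}/a_{xx}\in\mathbb Z_{\le 0}$ for all $y\ne x$; if $a_{xx}\neq 0$ and $p(x)=1$ then $a_{xy}/a_{xx}\in\mathbb Z_{\le 0}$ for all $y\ne x$. For $x$ reflectable at $v$ the reflexion $r_x:v\to v'=(\mathfrak h,a',b',p')$ is defined as follows. Anisotropic case $a_{xx}\ne0$: $p'=p$, $a'(y)=a(y)-2\frac{a_{yx}}{a_{xx}}a(x)$, $b'(y)=b(y)-2\frac{a_{xy}}{a_{xx}}b(x)$. Isotropic case $a_{xx}=0$: $(a'(x),b'(x),p'(x))=(-a(x),-b(x),p(x))$; for $y\neq x$ with $a_{xy}=0$, $(a'(y),b'(y),p'(y))=(a(y),b(y),p(y))$; for $y$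 with $a_{xy}\ne0$, $(a'(y),b'(y),p'(y))=(a(y)+\frac{a_{yx}}{a_{xy}}a(x),\,b(y)+b(x),\,1+p(y))$. The root groupoid $\mathcal R$ has the root data as objects; its arrows are generated by reflexions, tautological arrows $t_\theta:(\mathfrak h,a,b,p)\to(\mathfrak h',\theta\circ a,(\theta^* )^{-1}\circ b,p)$ for linear isomorphisms $\theta:\mathfrak h\to\mathfrak h'$, and homotheties $h_\lambda:(\mathfrak h,a,b,p)\to(\mathfrak h,\lambda a,b,p)$ for $\lambda:X\to\mathbb C^*$. Each generator induces a linear isomorphism of the spaces $\mathfrak h$ (the identity for reflexions and homotheties, $\theta$ for $t_\theta$), and two compositions of generators $v\to v'$ are identified iff they induce the same isomorphism $\mathfrak h(v)\to\mathfrak h(v')$. A component is a connected component of $\mathcal R$; it is indecomposable if for $v$ in it there is no partition $X=X_1\sqcup X_2$ into nonempty subsets with $a_{xy}=a_{yx}=0$ for $x\in X_1,y\in X_2$. Admissibility. The half-baked Lie superalgebra $\tilde{\mathfrak g}(v)$ is generated by $\mathfrak h(v)$ (even) and $\tilde e_x,\tilde f_x$ ($x\in X$, of parity $p(x)$) with relations $[\mathfrak h,\mathfrak h]=0$, $[h,\tilde e_x]=\langle b(x),h\rangle\tilde e_x$, $[h,\tilde f_x]=-\langle b(x),h\rangle\tilde f_x$, $[\tilde e_x,\tilde f_y]=0$ for $x\ne y$, $[\tilde e_x,\tilde f_x]=a(x)$. A component $\mathcal R_0$ is admissible if there is a collection of quotients $\mathfrak g(v)=\tilde{\mathfrak g}(v)/I(v)$,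 $v\in\mathcal R_0$, with $I(v)\cap\mathfrak h(v)=0$, such that for each arrow $v\to v'$ in $\mathcal R_0$ the induced isomorphism $\mathfrak h(v)\to\mathfrak h(v')$ extends to an isomorphism $\mathfrak g(v)\to\mathfrak g(v')$. Equivalently: at every $v\in\mathcal R_0$, if $x$ is reflectable at $v$ and $a_{xy}=0$ then $a_{yx}=0$. Skeleton and Weyl group. $\mathrm{Sk}(v)$ is the set of objects obtained from $v$ by chains of reflexions, $\mathrm{Sp}(v)\subset\mathrm{Sk}(v)$ those obtained by chains of isotropic reflexions; all have the same $\mathfrak h=\mathfrak h(v)$. Real roots: $\Delta^{re}=\{b_u(x):u\in\mathrm{Sk}(v),x\in X\}$. A real root $\alpha=b_u(x)$ with $x$ reflectable at $u$ and $a_{xx}\ne0$ at $u$ is called anisotropic; $\Delta_{an}$ is the set of these; $\alpha^\vee=2a_u(x)/a_{xx}$ (independent of choices), $s_\alpha(h)=h-\langle\alpha,h\rangle\alpha^\vee$. $W(v)\subset GL(\mathfrak h)$ is generated by all $s_\alpha$, $\alpha\in\Delta_{an}$. $W(v)$ acts on $\mathrm{Sk}(v)$: $w(u)$ is the unique vertex of $\mathrm{Sk}(v)$ with $a_{w(u)}(y)=w(a_u(y))$, $b_{w(u)}(y)=w(b_u(y))$, $p_{w(u)}=p_u$. An anisotropic real root is $v$-principal if it equals $b_{v'}(x)$ for some $v'\in\mathrm{Sp}(v)$, $x\in X$. $W(v)$ is generated by the reflections in $v$-principal roots, and $\ell(w)$ is the minimal number of such reflections in an expression of $w$. For $u\in\mathrm{Sk}(v)$,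 $\Delta^+_{an}(u)=\Delta_{an}\cap\sum_{x}\mathbb Z_{\ge0}b_u(x)$. *)

theory Defs
  imports Complex_Main "HOL-Library.Z2" "HOL-Library.Nonpos_Ints"
begin

section \<open>Complex vector spaces\<close>

class complex_vector = ab_group_add +
  fixes scaleC :: "complex \<Rightarrow> 'a \<Rightarrow> 'a"  (infixr \<open>*\<^sub>C\<close> 75)
  assumes scaleC_add_right: "c *\<^sub>C (s + t) = c *\<^sub>C s + c *\<^sub>C t"
    and scaleC_add_left: "(c + d) *\<^sub>C s = c *\<^sub>C s + d *\<^sub>C s"
    and scaleC_scaleC: "c *\<^sub>C (d *\<^sub>C s) = (c * d) *\<^sub>C s"
    and scaleC_one: "1 *\<^sub>C s = s"

global_interpretation cvec: vector_space "scaleC :: complex \<Rightarrow> 'h \<Rightarrow> 'h::complex_vector"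
  by unfold_locales (rule scaleC_add_right scaleC_add_left scaleC_scaleC scaleC_one)+

text \<open>
  The dual of a subspace \<open>S\<close>. A functional on \<open>S\<close> is represented by the function on the ambient
  space that extends it by zero off \<open>S\<close>, so that equality of functionals is equality of functions.
  These functions are usually not linear on the ambient space.
\<close>

definition dual_space :: "'h::complex_vector set \<Rightarrow> ('h \<Rightarrow> complex) set" where
  "dual_space S = {f. (\<forall>s\<in>S. \<forall>t\<in>S. f (s + t) = f s + f t) \<and>
                      (\<forall>c. \<forall>s\<in>S. f (c *\<^sub>C s) = c * f s) \<and>
                      (\<forall>s. s \<notin> S \<longrightarrow> f s = 0)}"

definition linear_embedding_on :: "'h::complex_vector set \<Rightarrow> ('h \<Rightarrow> 'h) \<Rightarrow> bool" where
  "linear_embedding_on S \<theta> \<longleftrightarrow>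
     inj_on \<theta> S \<and> (\<forall>s\<in>S. \<forall>t\<in>S. \<theta> (s + t) = \<theta> s + \<theta> t) \<and>
     (\<forall>c. \<forall>s\<in>S. \<theta> (c *\<^sub>C s) = c *\<^sub>C \<theta> s)"


section \<open>Root data and reflexions\<close>

text \<open>
  The vector spaces of the root data are the finite-dimensional subspaces of an arbitrary complex
  vector space \<open>'h\<close>, which plays the role of a universe; the index set \<open>X\<close> is the finite type \<open>'x\<close>.
\<close>

record ('h, 'x) root_datum =
  hspace :: "'h set"
  avec :: "'x \<Rightarrow> 'h"
  bvec :: "'x \<Rightarrow> 'h \<Rightarrow> complex"
  par :: "'x \<Rightarrow> bit"

definition is_root_datum :: "('h::complex_vector, 'x::finite) root_datum \<Rightarrow> bool" where
  "is_root_datum v \<longleftrightarrow>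
     cvec.subspace (hspace v) \<and> (\<exists>B. finite B \<and> cvec.span B = hspace v) \<and>
     (\<forall>x. avec v x \<in> hspace v) \<and> (\<forall>x. bvec v x \<in> dual_space (hspace v)) \<and>
     (\<forall>c. (\<Sum>x\<in>UNIV. c x *\<^sub>C avec v x) = 0 \<longrightarrow> (\<forall>x. c x = 0)) \<and>
     (\<forall>c. (\<forall>t\<in>hspace v. (\<Sum>x\<in>UNIV. c x * bvec v x t) = 0) \<longrightarrow> (\<forall>x. c x = 0))"

definition cartan :: "('h, 'x) root_datum \<Rightarrow> 'x \<Rightarrow> 'x \<Rightarrow> complex" where
  "cartan v x y = bvec v y (avec v x)"

definition reflectable :: "('h, 'x) root_datum \<Rightarrow> 'x \<Rightarrow> bool" where
  "reflectable v x \<longleftrightarrow>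
     (cartan v x x = 0 \<longrightarrow> par v x = 1) \<and>
     (cartan v x x \<noteq> 0 \<and> par v x = 0 \<longrightarrow>
        (\<forall>y. y \<noteq> x \<longrightarrow> 2 * cartan v x y / cartan v x x \<in> \<int>\<^sub>\<le>\<^sub>0)) \<and>
     (cartan v x x \<noteq> 0 \<and> par v x = 1 \<longrightarrow>
        (\<forall>y. y \<noteq> x \<longrightarrow> cartan v x y / cartan v x x \<in> \<int>\<^sub>\<le>\<^sub>0))"

definition reflexion_aniso ::
  "'x \<Rightarrow> ('h::complex_vector, 'x) root_datum \<Rightarrow> ('h, 'x) root_datum" where
  "reflexion_aniso x v =
     \<lparr> hspace = hspace v,
       avec = (\<lambda>y. avec v y - (2 * cartan v y x / cartan v x x) *\<^sub>C avec v x),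
       bvec = (\<lambda>y t. bvec v y t - 2 * cartan v x y / cartan v x x * bvec v x t),
       par = par v \<rparr>"

definition reflexion_iso ::
  "'x \<Rightarrow> ('h::complex_vector, 'x) root_datum \<Rightarrow> ('h, 'x) root_datum" where
  "reflexion_iso x v =
     \<lparr> hspace = hspace v,
       avec = (\<lambda>y. if y = x then - avec v x
                   else if cartan v x y = 0 then avec v y
                   else avec v y + (cartan v y x / cartan v x y) *\<^sub>C avec v x),
       bvec = (\<lambda>y. if y = x then (\<lambda>t. - bvec v x t)
                   else if cartan v x y = 0 then bvec v y
                   else (\<lambda>t. bvec v y t + bvec v x t)),
       par = (\<lambda>y. if y = x then par v x
                  else if cartan v x y = 0 then par v y
                  else 1 + par v y) \<rparr>"

definition reflexion ::
  "'x \<Rightarrow> ('h::complex_vector, 'x) root_datum \<Rightarrow> ('h, 'x) root_datum" where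
  "reflexion x v = (if cartan v x x \<noteq> 0 then reflexion_aniso x v else reflexion_iso x v)"


section \<open>The root groupoid\<close>

definition tautological ::
  "('h \<Rightarrow> 'h) \<Rightarrow> ('h::complex_vector, 'x) root_datum \<Rightarrow> ('h, 'x) root_datum" where
  "tautological \<theta> v =
     \<lparr> hspace = \<theta> ` hspace v,
       avec = (\<lambda>x. \<theta> (avec v x)),
       bvec = (\<lambda>x t. if t \<in> \<theta> ` hspace v then bvec v x (inv_into (hspace v) \<theta> t) else 0),
       par = par v \<rparr>"

definition homothety ::
  "('x \<Rightarrow> complex) \<Rightarrow> ('h::complex_vector, 'x) root_datum \<Rightarrow> ('h, 'x) root_datum" where
  "homothety l v = v\<lparr> avec := (\<lambda>x. l x *\<^sub>C avec v x) \<rparr>"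

text \<open>
  \<open>arrow v \<theta> v'\<close>: some composition of generators and their inverses from \<open>v\<close> to \<open>v'\<close> induces
  \<open>\<theta>\<close> on \<open>hspace v\<close>. Arrows with the same ends are identified iff they induce the same
  isomorphism, so an arrow is given by the restriction of \<open>\<theta>\<close> to \<open>hspace v\<close>; the values of \<open>\<theta>\<close>
  elsewhere are irrelevant.
\<close>

inductive arrow ::
  "('h::complex_vector, 'x::finite) root_datum \<Rightarrow> ('h \<Rightarrow> 'h) \<Rightarrow> ('h, 'x) root_datum \<Rightarrow> bool" where
  arrow_reflexion: "is_root_datum v \<Longrightarrow> reflectable v x \<Longrightarrow> arrow v id (reflexion x v)"
| arrow_tautological: "is_root_datum v \<Longrightarrow> linear_embedding_on (hspace v) \<theta> \<Longrightarrow>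
    arrow v \<theta> (tautological \<theta> v)"
| arrow_homothety: "is_root_datum v \<Longrightarrow> (\<And>x. l x \<noteq> 0) \<Longrightarrow> arrow v id (homothety l v)"
| arrow_id: "is_root_datum v \<Longrightarrow> arrow v id v"
| arrow_comp: "arrow v \<theta> u \<Longrightarrow> arrow u \<eta> w \<Longrightarrow> arrow v (\<eta> \<circ> \<theta>) w"
| arrow_inv: "arrow v \<theta> u \<Longrightarrow> arrow u (inv_into (hspace v) \<theta>) v"

definition component ::
  "('h::complex_vector, 'x::finite) root_datum \<Rightarrow> ('h, 'x) root_datum set" where
  "component v = {u. \<exists>\<theta>. arrow v \<theta> u}"

definition indecomposable :: "('h, 'x) root_datum set \<Rightarrow> bool" where
  "indecomposable C \<longleftrightarrow>
     (\<forall>v\<in>C. \<not> (\<exists>X1 X2. X1 \<noteq> {} \<and> X2 \<noteq> {} \<and> X1 \<inter> X2 = {} \<and> X1 \<union> X2 = UNIV \<and>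
        (\<forall>x\<in>X1. \<forall>y\<in>X2. cartan v x y = 0 \<and> cartan v y x = 0)))"


section \<open>The half-baked Lie superalgebra and its quotients\<close>

text \<open>
  The half-baked Lie superalgebra of \<open>v\<close> is presented as the algebra of Lie superalgebra terms in
  the generators modulo the smallest congruence \<open>half_baked v\<close> containing the axioms of a complex
  Lie superalgebra and the defining relations; its elements are the classes of terms.
\<close>

datatype ('h, 'x) lie_term =
    Cartan 'h
  | E 'x
  | F 'x
  | Zero
  | Plus "('h, 'x) lie_term" "('h, 'x) lie_term"
  | Scale complex "('h, 'x) lie_term"
  | Bracket "('h, 'x) lie_term" "('h, 'x) lie_term"

inductive homogeneous :: "('h, 'x) root_datum \<Rightarrow> bit \<Rightarrow> ('h, 'x) lie_term \<Rightarrow> bool"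
  for v where
  "homogeneous v 0 (Cartan h)"
| "homogeneous v (par v x) (E x)"
| "homogeneous v (par v x) (F x)"
| "homogeneous v i Zero"
| "homogeneous v i s \<Longrightarrow> homogeneous v i t \<Longrightarrow> homogeneous v i (Plus s t)"
| "homogeneous v i s \<Longrightarrow> homogeneous v i (Scale c s)"
| "homogeneous v i s \<Longrightarrow> homogeneous v j t \<Longrightarrow> homogeneous v (i + j) (Bracket s t)"

definition koszul :: "bit \<Rightarrow> bit \<Rightarrow> complex" where
  "koszul i j = (if i = 1 \<and> j = 1 then -1 else 1)"

text \<open>
  Only the vectors of \<open>hspace v\<close> are generators; by rule \<open>hb_outside\<close> the remaining symbols
  \<open>Cartan h\<close> are redundant names for zero.
\<close>

inductive half_baked ::
  "('h::complex_vector, 'x) root_datum \<Rightarrow> ('h, 'x) lie_term \<Rightarrow> ('h, 'x) lie_term \<Rightarrow> bool"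
  for v where
  hb_refl: "half_baked v s s"
| hb_sym: "half_baked v s t \<Longrightarrow> half_baked v t s"
| hb_trans: "half_baked v s t \<Longrightarrow> half_baked v t u \<Longrightarrow> half_baked v s u"
| hb_cong_plus: "half_baked v s s' \<Longrightarrow> half_baked v t t' \<Longrightarrow> half_baked v (Plus s t) (Plus s' t')"
| hb_cong_scale: "half_baked v s s' \<Longrightarrow> half_baked v (Scale c s) (Scale c s')"
| hb_cong_bracket:
    "half_baked v s s' \<Longrightarrow> half_baked v t t' \<Longrightarrow> half_baked v (Bracket s t) (Bracket s' t')"

| hb_plus_assoc: "half_baked v (Plus (Plus s t) u) (Plus s (Plus t u))"
| hb_plus_comm: "half_baked v (Plus s t) (Plus t s)"
| hb_plus_zero: "half_baked v (Plus Zero s) s"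
| hb_plus_minus: "half_baked v (Plus s (Scale (-1) s)) Zero"
| hb_scale_plus: "half_baked v (Scale c (Plus s t)) (Plus (Scale c s) (Scale c t))"
| hb_plus_scale: "half_baked v (Scale (c + d) s) (Plus (Scale c s) (Scale d s))"
| hb_scale_scale: "half_baked v (Scale c (Scale d s)) (Scale (c * d) s)"
| hb_scale_one: "half_baked v (Scale 1 s) s"

| hb_bracket_plus_left: "half_baked v (Bracket (Plus s t) u) (Plus (Bracket s u) (Bracket t u))"
| hb_bracket_plus_right: "half_baked v (Bracket u (Plus s t)) (Plus (Bracket u s) (Bracket u t))"
| hb_bracket_scale_left: "half_baked v (Bracket (Scale c s) t) (Scale c (Bracket s t))"
| hb_bracket_scale_right: "half_baked v (Bracket s (Scale c t)) (Scale c (Bracket s t))"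
| hb_skew: "homogeneous v i s \<Longrightarrow> homogeneous v j t \<Longrightarrow>
    half_baked v (Bracket s t) (Scale (- koszul i j) (Bracket t s))"
| hb_jacobi: "homogeneous v i s \<Longrightarrow> homogeneous v j t \<Longrightarrow>
    half_baked v (Bracket s (Bracket t u))
      (Plus (Bracket (Bracket s t) u) (Scale (koszul i j) (Bracket t (Bracket s u))))"

| hb_outside: "h \<notin> hspace v \<Longrightarrow> half_baked v (Cartan h) Zero"
| hb_cartan_plus: "h \<in> hspace v \<Longrightarrow> k \<in> hspace v \<Longrightarrow>
    half_baked v (Cartan (h + k)) (Plus (Cartan h) (Cartan k))"
| hb_cartan_scale: "h \<in> hspace v \<Longrightarrow> half_baked v (Cartan (c *\<^sub>C h)) (Scale c (Cartan h))"
| hb_cartan_comm: "h \<in> hspace v \<Longrightarrow> k \<in> hspace v \<Longrightarrow>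
    half_baked v (Bracket (Cartan h) (Cartan k)) Zero"
| hb_cartan_E: "h \<in> hspace v \<Longrightarrow>
    half_baked v (Bracket (Cartan h) (E x)) (Scale (bvec v x h) (E x))"
| hb_cartan_F: "h \<in> hspace v \<Longrightarrow>
    half_baked v (Bracket (Cartan h) (F x)) (Scale (- bvec v x h) (F x))"
| hb_E_F_diff: "x \<noteq> y \<Longrightarrow> half_baked v (Bracket (E x) (F y)) Zero"
| hb_E_F_same: "half_baked v (Bracket (E x) (F x)) (Cartan (avec v x))"

text \<open>
  A (graded) ideal of the half-baked algebra, as the union of the classes belonging to it, and
  equality of two terms in the quotient by it.
\<close>

definition superideal ::
  "('h::complex_vector, 'x) root_datum \<Rightarrow> ('h, 'x) lie_term set \<Rightarrow> bool" where
  "superideal v I \<longleftrightarrow>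
     (\<forall>s t. s \<in> I \<longrightarrow> half_baked v s t \<longrightarrow> t \<in> I) \<and>
     Zero \<in> I \<and>
     (\<forall>s\<in>I. \<forall>t\<in>I. Plus s t \<in> I) \<and>
     (\<forall>c. \<forall>s\<in>I. Scale c s \<in> I) \<and>
     (\<forall>s\<in>I. \<forall>t. Bracket s t \<in> I \<and> Bracket t s \<in> I) \<and>
     (\<forall>s\<in>I. \<exists>s0\<in>I. \<exists>s1\<in>I. homogeneous v 0 s0 \<and> homogeneous v 1 s1 \<and>
        half_baked v s (Plus s0 s1))"

definition quot_eq ::
  "('h, 'x) lie_term set \<Rightarrow> ('h, 'x) lie_term \<Rightarrow> ('h, 'x) lie_term \<Rightarrow> bool" where
  "quot_eq I s t \<longleftrightarrow> Plus s (Scale (-1) t) \<in> I"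

text \<open>
  \<open>\<phi>\<close> induces an isomorphism of Lie superalgebras from the quotient for \<open>(v, I)\<close> to the
  quotient for \<open>(v', I')\<close>.
\<close>

definition superalgebra_iso ::
  "('h::complex_vector, 'x) root_datum \<Rightarrow> ('h, 'x) lie_term set \<Rightarrow>
   ('h, 'x) root_datum \<Rightarrow> ('h, 'x) lie_term set \<Rightarrow>
   (('h, 'x) lie_term \<Rightarrow> ('h, 'x) lie_term) \<Rightarrow> bool" where
  "superalgebra_iso v I v' I' \<phi> \<longleftrightarrow>
     (\<forall>s t. quot_eq I s t \<longleftrightarrow> quot_eq I' (\<phi> s) (\<phi> t)) \<and>
     (\<forall>t. \<exists>s. quot_eq I' (\<phi> s) t) \<and>
     (\<forall>s t. quot_eq I' (\<phi> (Plus s t)) (Plus (\<phi> s) (\<phi> t))) \<and>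
     (\<forall>c s. quot_eq I' (\<phi> (Scale c s)) (Scale c (\<phi> s))) \<and>
     (\<forall>s t. quot_eq I' (\<phi> (Bracket s t)) (Bracket (\<phi> s) (\<phi> t))) \<and>
     (\<forall>i s. homogeneous v i s \<longrightarrow> (\<exists>t. homogeneous v' i t \<and> quot_eq I' (\<phi> s) t))"

definition admissible :: "('h::complex_vector, 'x::finite) root_datum set \<Rightarrow> bool" where
  "admissible C \<longleftrightarrow>
     (\<exists>I. (\<forall>v\<in>C. superideal v (I v) \<and> (\<forall>h\<in>hspace v. Cartan h \<in> I v \<longrightarrow> h = 0)) \<and>
          (\<forall>v\<in>C. \<forall>v'\<in>C. \<forall>\<theta>. arrow v \<theta> v' \<longrightarrow>
             (\<exists>\<phi>. superalgebra_iso v (I v) v' (I v') \<phi> \<and>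
                  (\<forall>h\<in>hspace v. quot_eq (I v') (\<phi> (Cartan h)) (Cartan (\<theta> h))))))"


section \<open>Skeleton, Weyl group and length\<close>

inductive_set Sk ::
  "('h::complex_vector, 'x) root_datum \<Rightarrow> ('h, 'x) root_datum set" for v where
  Sk_refl: "v \<in> Sk v"
| Sk_step: "u \<in> Sk v \<Longrightarrow> reflectable u x \<Longrightarrow> reflexion x u \<in> Sk v"

inductive_set Sp ::
  "('h::complex_vector, 'x) root_datum \<Rightarrow> ('h, 'x) root_datum set" for v where
  Sp_refl: "v \<in> Sp v"
| Sp_step: "u \<in> Sp v \<Longrightarrow> reflectable u x \<Longrightarrow> cartan u x x = 0 \<Longrightarrow> reflexion x u \<in> Sp v"

definition anisotropic_roots ::
  "('h::complex_vector, 'x) root_datum \<Rightarrow> ('h \<Rightarrow> complex) set" where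
  "anisotropic_roots v = {bvec u x | u x. u \<in> Sk v \<and> reflectable u x \<and> cartan u x x \<noteq> 0}"

definition coroot ::
  "('h::complex_vector, 'x) root_datum \<Rightarrow> ('h \<Rightarrow> complex) \<Rightarrow> 'h" where
  "coroot v \<alpha> = (THE c. \<exists>u\<in>Sk v. \<exists>x. reflectable u x \<and> cartan u x x \<noteq> 0 \<and> bvec u x = \<alpha> \<and>
                       c = (2 / cartan u x x) *\<^sub>C avec u x)"

text \<open>
  Since \<open>\<alpha>\<close> vanishes off \<open>hspace v\<close>, the map \<open>root_reflection v \<alpha>\<close> is the identity there; hence
  elements of the Weyl group agree as functions iff they agree on \<open>hspace v\<close>.
\<close>

definition root_reflection ::
  "('h::complex_vector, 'x) root_datum \<Rightarrow> ('h \<Rightarrow> complex) \<Rightarrow> 'h \<Rightarrow> 'h" where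
  "root_reflection v \<alpha> h = h - \<alpha> h *\<^sub>C coroot v \<alpha>"

inductive_set weyl_group ::
  "('h::complex_vector, 'x) root_datum \<Rightarrow> ('h \<Rightarrow> 'h) set" for v where
  "\<alpha> \<in> anisotropic_roots v \<Longrightarrow> root_reflection v \<alpha> \<in> weyl_group v"
| "id \<in> weyl_group v"
| "w \<in> weyl_group v \<Longrightarrow> w' \<in> weyl_group v \<Longrightarrow> w \<circ> w' \<in> weyl_group v"
| "w \<in> weyl_group v \<Longrightarrow> inv w \<in> weyl_group v"

text \<open>The action on functionals is the contragredient one.\<close>

definition weyl_act ::
  "('h \<Rightarrow> 'h) \<Rightarrow> ('h::complex_vector, 'x) root_datum \<Rightarrow> ('h, 'x) root_datum" where
  "weyl_act w u = u\<lparr> avec := (\<lambda>y. w (avec u y)), bvec := (\<lambda>y. bvec u y \<circ> inv w) \<rparr>"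

definition principal_roots ::
  "('h::complex_vector, 'x) root_datum \<Rightarrow> ('h \<Rightarrow> complex) set" where
  "principal_roots v = {\<alpha> \<in> anisotropic_roots v. \<exists>u\<in>Sp v. \<exists>x. \<alpha> = bvec u x}"

definition weyl_length ::
  "('h::complex_vector, 'x) root_datum \<Rightarrow> ('h \<Rightarrow> 'h) \<Rightarrow> nat" where
  "weyl_length v w =
     (LEAST n. \<exists>\<alpha>s. length \<alpha>s = n \<and> set \<alpha>s \<subseteq> principal_roots v \<and>
                   w = foldr (\<lambda>\<alpha> g. root_reflection v \<alpha> \<circ> g) \<alpha>s id)"

text \<open>
  The set \<open>\<Delta>\<^sup>+\<^sub>a\<^sub>n(u)\<close> for \<open>u \<in> Sk v\<close>.
\<close>

definition positive_anisotropic_roots ::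
  "('h::complex_vector, 'x::finite) root_datum \<Rightarrow> ('h, 'x) root_datum \<Rightarrow> ('h \<Rightarrow> complex) set" where
  "positive_anisotropic_roots v u =
     anisotropic_roots v \<inter>
     {\<alpha>. \<exists>n :: 'x \<Rightarrow> nat. \<alpha> = (\<lambda>t. \<Sum>x\<in>UNIV. of_nat (n x) * bvec u x t)}"

end

theory Submission
  imports Defs
begin

text \<open>
  Let \<open>u\<close>, \<open>u'\<close> be vertices of the skeleton. The simple root \<open>b_u'(x)\<close> is a weight of \<open>g(u')\<close>, because
  \<open>[e_x, f_x] = a_u'(x) \<noteq> 0\<close>, hence of \<open>g(u)\<close>, and by the triangular decomposition of \<open>g(u)\<close> it is an
  integral combination of the \<open>b_u(y)\<close> with coefficients of one sign. Moreover \<open>b_u'(x) = b_u(y)\<close> forces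
  \<open>a_u'(x)\<close> and \<open>a_u(y)\<close> to be proportional. These two facts are all that admissibility is needed for.

  It follows that a reflexion at \<open>x\<close> changes the sign of no anisotropic root except \<open>\<plusminus>b_u(x)\<close>, so the positive
  anisotropic roots are the same throughout the spine, and a principal reflection \<open>s_\<alpha>\<close> makes \<open>\<alpha>\<close> the only
  positive anisotropic root that becomes negative. Along a path in the skeleton every vertex is the image of
  a vertex of the spine under a product of principal reflections, so these generate the Weyl group, and
  the exchange argument for Coxeter groups computes the length as the number of inversions.
\<close>

section \<open>Linear identities between Lie superalgebra terms\<close>

text \<open>The algebra exists only as terms modulo a congruence, and skew symmetry and the Jacobi
  identity are available for homogeneous terms only. So it is homogeneous terms that are placed in
  the span of the Cartan elements and of the words in the \<open>E\<close> alone or the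
  \<open>F\<close> alone; comparing eigenvalues of \<open>ad h\<close> then selects the spanning
  elements of a given weight.

  The sign statement rests on one comparison. A reflexion at \<open>x\<close>, isotropic or not,
  alters every simple root by a multiple of \<open>b_u(x)\<close>, hence leaves the coordinates of a
  root away from \<open>x\<close> unchanged. A positive anisotropic root other than
  \<open>b_u(x)\<close> has a positive coordinate away from \<open>x\<close>: were it a multiple of
  \<open>b_u(x)\<close>, integrality at the vertex where the root itself is simple would force the
  multiple to be 1. For isotropic \<open>x\<close> the vector \<open>b_u(x)\<close> is no
  anisotropic root at all, because proportional coroots make the vanishing of \<open>a_xx\<close>
  depend on the root alone.

  A principal root is simple at some vertex of the spine, but perhaps not at \<open>v\<close>.
  Equality of the positive systems along the spine lets its reflection act on the positive roots of
  \<open>v\<close> like a simple one.\<close>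

primrec coef :: "('h, 'x) lie_term \<Rightarrow> ('h, 'x) lie_term \<Rightarrow> complex" where
  "coef (Cartan h) = (\<lambda>a. of_bool (a = Cartan h))"
| "coef (E x) = (\<lambda>a. of_bool (a = E x))"
| "coef (F x) = (\<lambda>a. of_bool (a = F x))"
| "coef Zero = (\<lambda>a. 0)"
| "coef (Plus s t) = (\<lambda>a. coef s a + coef t a)"
| "coef (Scale c s) = (\<lambda>a. c * coef s a)"
| "coef (Bracket s t) = (\<lambda>a. of_bool (a = Bracket s t))"

text \<open>Only an upper bound for the support of \<open>coef\<close>: atoms whose coefficients
  cancel stay in the list. Brackets count as atoms and are not opened.\<close>

primrec summands :: "('h, 'x) lie_term \<Rightarrow> ('h, 'x) lie_term list" where
  "summands (Cartan h) = [Cartan h]"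
| "summands (E x) = [E x]"
| "summands (F x) = [F x]"
| "summands Zero = []"
| "summands (Plus s t) = summands s @ summands t"
| "summands (Scale c s) = summands s"
| "summands (Bracket s t) = [Bracket s t]"

primrec lincomb :: "(('h, 'x) lie_term \<Rightarrow> complex) \<Rightarrow> ('h, 'x) lie_term list \<Rightarrow> ('h, 'x) lie_term" where
  "lincomb f [] = Zero"
| "lincomb f (a # as) = Plus (Scale (f a) a) (lincomb f as)"

declare hb_trans [trans]

lemma hb_plus_left_comm:
  "half_baked v (Plus s (Plus t u)) (Plus t (Plus s u))"
  by (meson hb_plus_assoc hb_plus_comm hb_cong_plus hb_refl hb_sym hb_trans)

lemma hb_plus_interchange:
  "half_baked v (Plus (Plus a b) (Plus c d)) (Plus (Plus a c) (Plus b d))"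
proof -
  have "half_baked v (Plus (Plus a b) (Plus c d)) (Plus a (Plus b (Plus c d)))"
    by (rule hb_plus_assoc)
  also have "half_baked v \<dots> (Plus a (Plus c (Plus b d)))"
    by (intro hb_cong_plus hb_refl hb_plus_left_comm)
  also have "half_baked v \<dots> (Plus (Plus a c) (Plus b d))"
    by (rule hb_sym, rule hb_plus_assoc)
  finally show ?thesis .
qed

lemma hb_scale_zero_left: "half_baked v (Scale 0 s) Zero"
proof -
  \<comment> \<open>Scaling by 0 has no axiom of its own, so 0 is written as 1 + -1.\<close>
  have "half_baked v (Scale (1 + -1) s) (Plus (Scale 1 s) (Scale (-1) s))"
    by (rule hb_plus_scale)
  also have "half_baked v \<dots> (Plus s (Scale (-1) s))"
    by (intro hb_cong_plus hb_refl hb_scale_one)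
  also have "half_baked v \<dots> Zero"
    by (rule hb_plus_minus)
  finally show ?thesis by simp
qed

lemma hb_scale_zero_right: "half_baked v (Scale c Zero) Zero"
proof -
  have "half_baked v (Scale c Zero) (Scale c (Scale 0 Zero))"
    by (intro hb_cong_scale hb_sym[OF hb_scale_zero_left])
  also have "half_baked v \<dots> (Scale (c * 0) Zero)"
    by (rule hb_scale_scale)
  also have "half_baked v \<dots> Zero"
    by (simp add: hb_scale_zero_left)
  finally show ?thesis .
qed

lemma hb_plus_zero_right: "half_baked v (Plus s Zero) s"
  by (rule hb_trans[OF hb_plus_comm hb_plus_zero])

lemma hb_lincomb_plus:
  "half_baked v (lincomb (\<lambda>a. f a + g a) as) (Plus (lincomb f as) (lincomb g as))"
proof (induction as)
  case Nil
  show ?case by (simp add: hb_sym[OF hb_plus_zero])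
next
  case (Cons a as)
  have "half_baked v (lincomb (\<lambda>a. f a + g a) (a # as))
     (Plus (Plus (Scale (f a) a) (Scale (g a) a)) (Plus (lincomb f as) (lincomb g as)))"
    by (simp add: hb_cong_plus hb_plus_scale Cons)
  also have "half_baked v \<dots> (Plus (lincomb f (a # as)) (lincomb g (a # as)))"
    by (simp add: hb_plus_interchange)
  finally show ?case .
qed

lemma hb_lincomb_scale:
  "half_baked v (lincomb (\<lambda>a. c * f a) as) (Scale c (lincomb f as))"
proof (induction as)
  case Nil
  show ?case by (simp add: hb_sym[OF hb_scale_zero_right])
next
  case (Cons a as)
  have "half_baked v (lincomb (\<lambda>a. c * f a) (a # as))
     (Plus (Scale c (Scale (f a) a)) (Scale c (lincomb f as)))"
    by (simp add: hb_cong_plus hb_sym[OF hb_scale_scale] Cons)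
  also have "half_baked v \<dots> (Scale c (lincomb f (a # as)))"
    by (simp add: hb_sym[OF hb_scale_plus])
  finally show ?case .
qed

lemma hb_lincomb_zero:
  "b \<notin> set as \<Longrightarrow> half_baked v (lincomb (\<lambda>a. of_bool (a = b)) as) Zero"
proof (induction as)
  case Nil
  show ?case by (simp add: hb_refl)
next
  case (Cons a as)
  then have "half_baked v (lincomb (\<lambda>a. of_bool (a = b)) (a # as)) (Plus Zero Zero)"
    by (auto intro!: hb_cong_plus simp: hb_scale_zero_left)
  also have "half_baked v \<dots> Zero"
    by (rule hb_plus_zero)
  finally show ?case .
qed

lemma hb_lincomb_single:
  "distinct as \<Longrightarrow> b \<in> set as \<Longrightarrow> half_baked v (lincomb (\<lambda>a. of_bool (a = b)) as) b"
proof (induction as)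
  case Nil
  then show ?case by simp
next
  case (Cons a as)
  show ?case
  proof (cases "a = b")
    case True
    then have "half_baked v (lincomb (\<lambda>a. of_bool (a = b)) (a # as)) (Plus b Zero)"
      using Cons.prems by (auto intro!: hb_cong_plus hb_lincomb_zero simp: hb_scale_one)
    also have "half_baked v \<dots> b"
      by (rule hb_plus_zero_right)
    finally show ?thesis .
  next
    case False
    then have "half_baked v (lincomb (\<lambda>a. of_bool (a = b)) (a # as)) (Plus Zero b)"
      using Cons by (auto intro!: hb_cong_plus simp: hb_scale_zero_left)
    also have "half_baked v \<dots> b"
      by (rule hb_plus_zero)
    finally show ?thesis .
  qed
qed

text \<open>A normal form of terms under the vector space axioms. The list may be larger than the
  support, so that two terms can be expanded over the same list.\<close>

lemma hb_lincomb_coef: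
  "distinct as \<Longrightarrow> set (summands s) \<subseteq> set as \<Longrightarrow> half_baked v s (lincomb (coef s) as)"
proof (induction s)
  case Zero
  have "half_baked v (lincomb (\<lambda>a. 0 * 0) as) (Scale 0 (lincomb (\<lambda>a. 0) as))"
    by (rule hb_lincomb_scale)
  also have "half_baked v \<dots> Zero"
    by (rule hb_scale_zero_left)
  finally show ?case by (simp add: hb_sym)
next
  case (Plus s t)
  then have "half_baked v (Plus s t) (Plus (lincomb (coef s) as) (lincomb (coef t) as))"
    by (simp add: hb_cong_plus)
  also have "half_baked v \<dots> (lincomb (coef (Plus s t)) as)"
    by (simp add: hb_sym[OF hb_lincomb_plus])
  finally show ?case .
next
  case (Scale c s)
  then have "half_baked v (Scale c s) (Scale c (lincomb (coef s) as))"
    by (simp add: hb_cong_scale)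
  also have "half_baked v \<dots> (lincomb (coef (Scale c s)) as)"
    by (simp add: hb_sym[OF hb_lincomb_scale])
  finally show ?case .
qed (simp_all add: hb_sym[OF hb_lincomb_single])

text \<open>
  Proves every identity that follows from the vector space axioms alone: after applying the rule,
  both sides are compared coefficientwise by the simplifier, even when \<open>s\<close> and \<open>t\<close> contain
  variables.
\<close>

lemma hb_linear:
  assumes "coef s = coef t"
  shows "half_baked v s t"
proof -
  \<comment> \<open>One list for both terms, so that equal coefficients give literally the same
    normal form.\<close>
  define as where "as = remdups (summands s @ summands t)"
  have "half_baked v s (lincomb (coef s) as)"
    by (rule hb_lincomb_coef) (auto simp: as_def)
  also have "half_baked v \<dots> t"
    unfolding assms by (rule hb_sym, rule hb_lincomb_coef) (auto simp: as_def)
  finally show ?thesis .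
qed

section \<open>Weights in a quotient of the half-baked algebra\<close>

lemma koszul_zero [simp]: "koszul 0 j = 1" "koszul i 0 = 1"
  by (simp_all add: koszul_def)

locale hb_quotient =
  fixes v :: "('h::complex_vector, 'x::finite) root_datum" and I :: "('h, 'x) lie_term set"
  assumes root_datum: "is_root_datum v" and ideal: "superideal v I"
begin

section \<open>Vector space and bracket calculus modulo the ideal\<close>

abbreviation eqv (infix \<open>\<approx>\<close> 50) where "s \<approx> t \<equiv> quot_eq I s t"

lemma ideal_hb: "s \<in> I \<Longrightarrow> half_baked v s t \<Longrightarrow> t \<in> I"
  using ideal[unfolded superideal_def, THEN conjunct1] by blast

lemma ideal_zero: "Zero \<in> I"
  and ideal_plus: "s \<in> I \<Longrightarrow> t \<in> I \<Longrightarrow> Plus s t \<in> I"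
  and ideal_scale: "s \<in> I \<Longrightarrow> Scale c s \<in> I"
  and ideal_bracket_left: "s \<in> I \<Longrightarrow> Bracket s t \<in> I"
  and ideal_bracket_right: "s \<in> I \<Longrightarrow> Bracket t s \<in> I"
  using ideal[unfolded superideal_def, THEN conjunct2] by simp_all

lemma ideal_linear: "s \<in> I \<Longrightarrow> coef s = coef t \<Longrightarrow> t \<in> I"
  using ideal_hb hb_linear by blast

lemma eqv_hb: "half_baked v s t \<Longrightarrow> s \<approx> t"
  unfolding quot_eq_def
  by (rule ideal_hb[OF ideal_zero hb_sym[OF hb_trans[OF hb_cong_plus[OF _ hb_refl] hb_plus_minus]]])

lemma eqv_linear: "coef s = coef t \<Longrightarrow> s \<approx> t"
  by (intro eqv_hb hb_linear)

lemma eqv_refl [simp]: "s \<approx> s"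
  by (simp add: eqv_linear)

lemma eqv_sym: "s \<approx> t \<Longrightarrow> t \<approx> s"
  unfolding quot_eq_def
  by (erule ideal_linear[OF ideal_scale[of _ "-1"]]) simp

lemma eqv_trans [trans]: "s \<approx> t \<Longrightarrow> t \<approx> u \<Longrightarrow> s \<approx> u"
  unfolding quot_eq_def
  by (drule (1) ideal_plus, erule ideal_linear) auto

lemma eqv_plus: "s \<approx> s' \<Longrightarrow> t \<approx> t' \<Longrightarrow> Plus s t \<approx> Plus s' t'"
  unfolding quot_eq_def
  by (drule (1) ideal_plus, erule ideal_linear) (auto simp: algebra_simps)

lemma eqv_scale: "s \<approx> s' \<Longrightarrow> Scale c s \<approx> Scale c s'"
  unfolding quot_eq_def
  by (drule ideal_scale[of _ c], erule ideal_linear) (auto simp: algebra_simps)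

lemma bracket_plus_left: "Bracket (Plus s t) u \<approx> Plus (Bracket s u) (Bracket t u)"
  and bracket_plus_right: "Bracket u (Plus s t) \<approx> Plus (Bracket u s) (Bracket u t)"
  and bracket_scale_left: "Bracket (Scale c s) t \<approx> Scale c (Bracket s t)"
  and bracket_scale_right: "Bracket s (Scale c t) \<approx> Scale c (Bracket s t)"
  by (rule eqv_hb hb_bracket_plus_left hb_bracket_plus_right hb_bracket_scale_left
      hb_bracket_scale_right)+

lemma eqv_bracket_left:
  assumes "s \<approx> s'"
  shows "Bracket s t \<approx> Bracket s' t"
proof -
  have "half_baked v (Bracket (Plus s (Scale (-1) s')) t)
     (Plus (Bracket s t) (Scale (-1) (Bracket s' t)))"
    by (rule hb_trans[OF hb_bracket_plus_left hb_cong_plus[OF hb_refl hb_bracket_scale_left]])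
  then show ?thesis
    using assms ideal_bracket_left ideal_hb unfolding quot_eq_def by blast
qed

lemma eqv_bracket_right:
  assumes "s \<approx> s'"
  shows "Bracket t s \<approx> Bracket t s'"
proof -
  have "half_baked v (Bracket t (Plus s (Scale (-1) s')))
     (Plus (Bracket t s) (Scale (-1) (Bracket t s')))"
    by (rule hb_trans[OF hb_bracket_plus_right hb_cong_plus[OF hb_refl hb_bracket_scale_right]])
  then show ?thesis
    using assms ideal_bracket_right ideal_hb unfolding quot_eq_def by blast
qed

lemma eqv_bracket: "s \<approx> s' \<Longrightarrow> t \<approx> t' \<Longrightarrow> Bracket s t \<approx> Bracket s' t'"
  by (rule eqv_trans[OF eqv_bracket_left eqv_bracket_right])

lemma bracket_zero_left: "Bracket Zero t \<approx> Zero"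
proof -
  have "Bracket Zero t \<approx> Bracket (Scale 0 Zero) t"
    by (intro eqv_bracket_left eqv_linear) simp
  also have "\<dots> \<approx> Scale 0 (Bracket Zero t)" by (rule bracket_scale_left)
  also have "\<dots> \<approx> Zero" by (rule eqv_linear) simp
  finally show ?thesis .
qed

lemma bracket_zero_right: "Bracket t Zero \<approx> Zero"
proof -
  have "Bracket t Zero \<approx> Bracket t (Scale 0 Zero)"
    by (intro eqv_bracket_right eqv_linear) simp
  also have "\<dots> \<approx> Scale 0 (Bracket t Zero)" by (rule bracket_scale_right)
  also have "\<dots> \<approx> Zero" by (rule eqv_linear) simp
  finally show ?thesis .
qed

lemma eqv_zero_iff: "s \<approx> Zero \<longleftrightarrow> s \<in> I"
proof -
  have "coef (Plus s (Scale (-1) Zero)) = coef s" by simp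
  then show ?thesis
    unfolding quot_eq_def by (auto elim: ideal_linear)
qed

lemma jacobi:
  assumes "homogeneous v i s" "homogeneous v j t"
  shows "Bracket s (Bracket t u) \<approx>
    Plus (Bracket (Bracket s t) u) (Scale (koszul i j) (Bracket t (Bracket s u)))"
  by (rule eqv_hb, rule hb_jacobi[OF assms])

text \<open>The terms whose classes lie in the linear span of the classes of \<open>A\<close>.
  Closure under equality in the quotient has to be a rule, since terms themselves satisfy no vector
  space laws.\<close>

inductive_set lspan :: "('h, 'x) lie_term set \<Rightarrow> ('h, 'x) lie_term set" for A where
  lspan_base: "t \<in> A \<Longrightarrow> t \<in> lspan A"
| lspan_zero: "Zero \<in> lspan A"
| lspan_plus: "s \<in> lspan A \<Longrightarrow> t \<in> lspan A \<Longrightarrow> Plus s t \<in> lspan A"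
| lspan_scale: "s \<in> lspan A \<Longrightarrow> Scale c s \<in> lspan A"
| lspan_eqv: "s \<in> lspan A \<Longrightarrow> s \<approx> t \<Longrightarrow> t \<in> lspan A"

lemma lspan_eqv': "t \<approx> s \<Longrightarrow> s \<in> lspan A \<Longrightarrow> t \<in> lspan A"
  by (rule lspan_eqv[OF _ eqv_sym])

lemma lspan_mono:
  assumes "t \<in> lspan A" and "A \<subseteq> B"
  shows "t \<in> lspan B"
  using assms(1)
proof (induction rule: lspan.induct)
  case (lspan_eqv s t)
  show ?case by (rule lspan.lspan_eqv[OF lspan_eqv.IH lspan_eqv.hyps(2)])
qed (use assms(2) in \<open>auto intro: lspan_base lspan_zero lspan_plus lspan_scale\<close>)

lemma lspan_bracket:
  assumes "t \<in> lspan A" and "\<And>a. a \<in> A \<Longrightarrow> Bracket g a \<in> lspan B"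
  shows "Bracket g t \<in> lspan B"
  using assms(1)
proof (induction rule: lspan.induct)
  case (lspan_plus s t)
  then show ?case by (intro lspan_eqv'[OF bracket_plus_right] lspan.lspan_plus)
next
  case (lspan_scale s c)
  then show ?case by (intro lspan_eqv'[OF bracket_scale_right] lspan.lspan_scale)
next
  case (lspan_eqv s t)
  show ?case by (rule lspan.lspan_eqv[OF lspan_eqv.IH eqv_bracket_right[OF lspan_eqv.hyps(2)]])
next
  case lspan_zero
  show ?case by (rule lspan_eqv'[OF bracket_zero_right lspan.lspan_zero])
qed (auto intro: assms(2))

lemma lspan_empty: "t \<in> lspan {} \<Longrightarrow> t \<approx> Zero"
proof (induction rule: lspan.induct)
  case (lspan_plus s t)
  then have "Plus s t \<approx> Plus Zero Zero" by (intro eqv_plus)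
  also have "\<dots> \<approx> Zero" by (rule eqv_linear) simp
  finally show ?case .
next
  case (lspan_scale s c)
  then have "Scale c s \<approx> Scale c Zero" by (intro eqv_scale)
  also have "\<dots> \<approx> Zero" by (rule eqv_linear) simp
  finally show ?case .
next
  case (lspan_eqv s t)
  show ?case by (rule eqv_trans[OF eqv_sym[OF lspan_eqv.hyps(2)] lspan_eqv.IH])
qed simp_all

lemma lspan_singleton: "t \<in> lspan {a} \<Longrightarrow> \<exists>c. t \<approx> Scale c a"
proof (induction rule: lspan.induct)
  case (lspan_base t)
  have "a \<approx> Scale 1 a" by (rule eqv_linear) simp
  with lspan_base show ?case by blast
next
  case lspan_zero
  have "Zero \<approx> Scale 0 a" by (rule eqv_linear) simp
  then show ?case by blast
next
  case (lspan_plus s t)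
  then obtain c d where "s \<approx> Scale c a" "t \<approx> Scale d a" by blast
  then have "Plus s t \<approx> Plus (Scale c a) (Scale d a)" by (intro eqv_plus)
  also have "\<dots> \<approx> Scale (c + d) a" by (rule eqv_linear) (simp add: algebra_simps)
  finally show ?case by blast
next
  case (lspan_scale s d)
  then obtain c where "s \<approx> Scale c a" by blast
  then have "Scale d s \<approx> Scale d (Scale c a)" by (intro eqv_scale)
  also have "\<dots> \<approx> Scale (d * c) a" by (rule eqv_linear) (simp add: algebra_simps)
  finally show ?case by blast
next
  case (lspan_eqv s t)
  then show ?case using eqv_trans[OF eqv_sym[OF lspan_eqv.hyps(2)]] lspan_eqv.IH by blast
qed

text \<open>The zero class has every weight, so two weights of one term can be compared only when
  the term lies outside \<open>I\<close>. Only the values of the weight on \<open>hspace v\<close>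
  matter.\<close>

definition wt :: "('h \<Rightarrow> complex) \<Rightarrow> ('h, 'x) lie_term \<Rightarrow> bool" where
  "wt \<gamma> t \<longleftrightarrow> (\<forall>h\<in>hspace v. Bracket (Cartan h) t \<approx> Scale (\<gamma> h) t)"

lemma wt_eqv:
  assumes "wt \<gamma> s" "s \<approx> t"
  shows "wt \<gamma> t"
  unfolding wt_def
proof
  fix h assume "h \<in> hspace v"
  have "Bracket (Cartan h) t \<approx> Bracket (Cartan h) s"
    by (rule eqv_bracket_right[OF eqv_sym[OF assms(2)]])
  also have "\<dots> \<approx> Scale (\<gamma> h) s"
    using assms \<open>h \<in> hspace v\<close> by (simp add: wt_def)
  also have "\<dots> \<approx> Scale (\<gamma> h) t"
    by (intro eqv_scale assms)
  finally show "Bracket (Cartan h) t \<approx> Scale (\<gamma> h) t" .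
qed

lemma wt_zero: "wt \<gamma> Zero"
  unfolding wt_def
proof
  fix h
  have "Bracket (Cartan h) Zero \<approx> Zero" by (rule bracket_zero_right)
  also have "\<dots> \<approx> Scale (\<gamma> h) Zero" by (rule eqv_linear) simp
  finally show "Bracket (Cartan h) Zero \<approx> Scale (\<gamma> h) Zero" .
qed

lemma wt_plus:
  assumes "wt \<gamma> s" "wt \<gamma> t"
  shows "wt \<gamma> (Plus s t)"
  unfolding wt_def
proof
  fix h assume "h \<in> hspace v"
  have "Bracket (Cartan h) (Plus s t) \<approx> Plus (Bracket (Cartan h) s) (Bracket (Cartan h) t)"
    by (rule bracket_plus_right)
  also have "\<dots> \<approx> Plus (Scale (\<gamma> h) s) (Scale (\<gamma> h) t)"
    using assms \<open>h \<in> hspace v\<close> by (intro eqv_plus) (simp_all add: wt_def)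
  also have "\<dots> \<approx> Scale (\<gamma> h) (Plus s t)"
    by (rule eqv_linear) (simp add: algebra_simps)
  finally show "Bracket (Cartan h) (Plus s t) \<approx> Scale (\<gamma> h) (Plus s t)" .
qed

lemma wt_scale:
  assumes "wt \<gamma> s"
  shows "wt \<gamma> (Scale c s)"
  unfolding wt_def
proof
  fix h assume "h \<in> hspace v"
  have "Bracket (Cartan h) (Scale c s) \<approx> Scale c (Bracket (Cartan h) s)"
    by (rule bracket_scale_right)
  also have "\<dots> \<approx> Scale c (Scale (\<gamma> h) s)"
    using assms \<open>h \<in> hspace v\<close> by (intro eqv_scale) (simp_all add: wt_def)
  also have "\<dots> \<approx> Scale (\<gamma> h) (Scale c s)"
    by (rule eqv_linear) (simp add: algebra_simps)
  finally show "Bracket (Cartan h) (Scale c s) \<approx> Scale (\<gamma> h) (Scale c s)" .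
qed

text \<open>By the Jacobi identity \<open>ad h\<close> is a derivation; no sign appears because
  \<open>h\<close> is even, and homogeneity of \<open>s\<close> is what the Jacobi rule asks
  for.\<close>

lemma wt_bracket:
  assumes "wt \<gamma> s" "wt \<delta> t" "homogeneous v i s"
  shows "wt (\<lambda>h. \<gamma> h + \<delta> h) (Bracket s t)"
  unfolding wt_def
proof
  fix h assume h: "h \<in> hspace v"
  have "Bracket (Cartan h) (Bracket s t) \<approx>
      Plus (Bracket (Bracket (Cartan h) s) t) (Scale 1 (Bracket s (Bracket (Cartan h) t)))"
    using jacobi[OF homogeneous.intros(1) assms(3)] by simp
  also have "\<dots> \<approx> Plus (Bracket (Scale (\<gamma> h) s) t) (Scale 1 (Bracket s (Scale (\<delta> h) t)))"
    using assms h by (intro eqv_plus eqv_scale eqv_bracket eqv_refl) (simp_all add: wt_def)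
  also have "\<dots> \<approx> Plus (Scale (\<gamma> h) (Bracket s t)) (Scale 1 (Scale (\<delta> h) (Bracket s t)))"
    by (intro eqv_plus eqv_scale bracket_scale_left bracket_scale_right)
  also have "\<dots> \<approx> Scale (\<gamma> h + \<delta> h) (Bracket s t)"
    by (rule eqv_linear) (simp add: algebra_simps)
  finally show "Bracket (Cartan h) (Bracket s t) \<approx> Scale (\<gamma> h + \<delta> h) (Bracket s t)" .
qed

lemma wt_lspan:
  assumes "t \<in> lspan A" and "\<And>a. a \<in> A \<Longrightarrow> wt \<gamma> a"
  shows "wt \<gamma> t"
  using assms(1)
proof (induction rule: lspan.induct)
  case (lspan_eqv s t)
  then show ?case by (intro wt_eqv[OF lspan_eqv.IH lspan_eqv.hyps(2)])
qed (simp_all add: assms(2) wt_zero wt_plus wt_scale)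

text \<open>A sum of \<open>n\<close> weight vectors whose weights all differ from
  \<open>\<alpha>\<close> somewhere on \<open>hspace v\<close>. The weights may repeat and summands
  may vanish; the number \<open>n\<close> is kept for the induction in
  \<open>other_wts_zero\<close>.\<close>

primrec other_wts :: "('h \<Rightarrow> complex) \<Rightarrow> nat \<Rightarrow> ('h, 'x) lie_term \<Rightarrow> bool" where
  "other_wts \<alpha> 0 s \<longleftrightarrow> s \<approx> Zero"
| "other_wts \<alpha> (Suc n) s \<longleftrightarrow> (\<exists>\<gamma> t r. wt \<gamma> t \<and> (\<exists>h\<in>hspace v. \<gamma> h \<noteq> \<alpha> h) \<and> other_wts \<alpha> n r \<and> s \<approx> Plus t r)"

lemma other_wts_eqv:
  assumes "other_wts \<alpha> n s" "t \<approx> s"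
  shows "other_wts \<alpha> n t"
proof (cases n)
  case 0
  then show ?thesis using assms(1) eqv_trans[OF assms(2)] by simp
next
  case (Suc m)
  then show ?thesis using assms(1) eqv_trans[OF assms(2)] by (simp, blast)
qed

lemma other_wts_SucI:
  assumes "wt \<gamma> t" "h \<in> hspace v" "\<gamma> h \<noteq> \<alpha> h" "other_wts \<alpha> n r" "s \<approx> Plus t r"
  shows "other_wts \<alpha> (Suc n) s"
  using assms by (simp, blast)

lemma other_wts_SucE:
  assumes "other_wts \<alpha> (Suc n) s"
  obtains \<gamma> t h r where "wt \<gamma> t" "h \<in> hspace v" "\<gamma> h \<noteq> \<alpha> h" "other_wts \<alpha> n r" "s \<approx> Plus t r"
  using assms by (simp, blast)

lemma other_wts_plus: "other_wts \<alpha> m s \<Longrightarrow> other_wts \<alpha> n t \<Longrightarrow> other_wts \<alpha> (m + n) (Plus s t)"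
proof (induction m arbitrary: s)
  case 0
  then have "Plus s t \<approx> Plus Zero t" by (simp add: eqv_plus)
  also have "\<dots> \<approx> t" by (rule eqv_linear) simp
  finally show ?case using 0 other_wts_eqv by auto
next
  case (Suc m)
  from Suc.prems(1) obtain \<gamma> t' h r where
    *: "wt \<gamma> t'" "h \<in> hspace v" "\<gamma> h \<noteq> \<alpha> h" "other_wts \<alpha> m r" "s \<approx> Plus t' r"
    by (rule other_wts_SucE)
  have "Plus s t \<approx> Plus (Plus t' r) t" by (intro eqv_plus * eqv_refl)
  also have "\<dots> \<approx> Plus t' (Plus r t)" by (rule eqv_linear) (simp add: algebra_simps)
  finally have "other_wts \<alpha> (Suc (m + n)) (Plus s t)"
    using *(1-3) Suc.IH[OF *(4) Suc.prems(2)] by (intro other_wts_SucI)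
  then show ?case by (simp del: other_wts.simps)
qed

lemma other_wts_scale: "other_wts \<alpha> n s \<Longrightarrow> other_wts \<alpha> n (Scale c s)"
proof (induction n arbitrary: s)
  case 0
  then have "Scale c s \<approx> Scale c Zero" by (simp add: eqv_scale)
  also have "\<dots> \<approx> Zero" by (rule eqv_linear) simp
  finally show ?case by simp
next
  case (Suc n)
  from Suc.prems(1) obtain \<gamma> t h r where
    *: "wt \<gamma> t" "h \<in> hspace v" "\<gamma> h \<noteq> \<alpha> h" "other_wts \<alpha> n r" "s \<approx> Plus t r"
    by (rule other_wts_SucE)
  have "Scale c s \<approx> Scale c (Plus t r)" by (intro eqv_scale *)
  also have "\<dots> \<approx> Plus (Scale c t) (Scale c r)" by (rule eqv_linear) (simp add: algebra_simps)
  finally show ?case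
    by (rule other_wts_SucI[OF wt_scale[OF *(1)] *(2,3) Suc.IH[OF *(4)]])
qed

text \<open>Each summand is an eigenvector of \<open>ad h\<close>, so it is merely rescaled,
  possibly to zero, and the number of summands stays \<open>n\<close>.\<close>

lemma other_wts_ad:
  assumes "h \<in> hspace v"
  shows "other_wts \<alpha> n s \<Longrightarrow> other_wts \<alpha> n (Plus (Bracket (Cartan h) s) (Scale c s))"
proof (induction n arbitrary: s)
  case 0
  then have "Plus (Bracket (Cartan h) s) (Scale c s) \<approx> Plus (Bracket (Cartan h) Zero) (Scale c Zero)"
    by (simp add: eqv_plus eqv_scale eqv_bracket)
  also have "\<dots> \<approx> Plus Zero (Scale c Zero)"
    by (intro eqv_plus eqv_refl bracket_zero_right)
  also have "\<dots> \<approx> Zero" by (rule eqv_linear) simp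
  finally show ?case by simp
next
  case (Suc n)
  from Suc.prems(1) obtain \<delta> t h' r where
    *: "wt \<delta> t" "h' \<in> hspace v" "\<delta> h' \<noteq> \<alpha> h'" "other_wts \<alpha> n r" "s \<approx> Plus t r"
    by (rule other_wts_SucE)
  have "Plus (Bracket (Cartan h) s) (Scale c s) \<approx>
      Plus (Bracket (Cartan h) (Plus t r)) (Scale c (Plus t r))"
    by (intro eqv_plus eqv_scale eqv_bracket * eqv_refl)
  also have "\<dots> \<approx> Plus (Plus (Bracket (Cartan h) t) (Bracket (Cartan h) r)) (Scale c (Plus t r))"
    by (intro eqv_plus eqv_refl bracket_plus_right)
  also have "\<dots> \<approx> Plus (Plus (Scale (\<delta> h) t) (Bracket (Cartan h) r)) (Scale c (Plus t r))"
    using *(1) assms by (intro eqv_plus eqv_refl) (simp add: wt_def)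
  also have "\<dots> \<approx> Plus (Scale (\<delta> h + c) t) (Plus (Bracket (Cartan h) r) (Scale c r))"
    by (rule eqv_linear) (simp add: algebra_simps)
  finally show ?case
    by (rule other_wts_SucI[OF wt_scale[OF *(1)] *(2,3) Suc.IH[OF *(4)]])
qed

lemma eqv_scale_zero:
  assumes "Scale c s \<approx> Zero" "c \<noteq> 0"
  shows "s \<approx> Zero"
proof -
  have "s \<approx> Scale (inverse c) (Scale c s)"
    using assms by (intro eqv_linear) (simp add: fun_eq_iff)
  also have "\<dots> \<approx> Scale (inverse c) Zero" by (intro eqv_scale assms)
  also have "\<dots> \<approx> Zero" by (rule eqv_linear) simp
  finally show ?thesis .
qed

text \<open>
  If \<open>s\<close> is a sum of \<open>n\<close> weight vectors, the first of weight \<open>\<gamma>\<close>, then \<open>ad h - \<gamma> h\<close> removes the first summand.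
\<close>

lemma other_wts_zero:
  "other_wts \<alpha> n s \<Longrightarrow> wt \<alpha> s \<Longrightarrow> s \<approx> Zero"
proof (induction n arbitrary: s)
  case 0
  then show ?case by simp
next
  case (Suc n)
  from Suc.prems(1) obtain \<gamma> t h r where
    *: "wt \<gamma> t" "h \<in> hspace v" "\<gamma> h \<noteq> \<alpha> h" "other_wts \<alpha> n r" "s \<approx> Plus t r"
    by (rule other_wts_SucE)
  define r' where "r' = Plus (Bracket (Cartan h) r) (Scale (- \<gamma> h) r)"
  have "Scale (\<alpha> h) s \<approx> Bracket (Cartan h) s"
    by (rule eqv_sym) (use Suc.prems(2) *(2) in \<open>simp add: wt_def\<close>)
  also have "\<dots> \<approx> Bracket (Cartan h) (Plus t r)" by (intro eqv_bracket_right *)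
  also have "\<dots> \<approx> Plus (Bracket (Cartan h) t) (Bracket (Cartan h) r)" by (rule bracket_plus_right)
  also have "\<dots> \<approx> Plus (Scale (\<gamma> h) t) (Bracket (Cartan h) r)"
    using *(1,2) by (intro eqv_plus eqv_refl) (simp add: wt_def)
  finally have "Plus (Scale (\<alpha> h) s) (Scale (- \<gamma> h) s) \<approx>
      Plus (Plus (Scale (\<gamma> h) t) (Bracket (Cartan h) r)) (Scale (- \<gamma> h) (Plus t r))"
    by (intro eqv_plus eqv_scale *)
  also have "\<dots> \<approx> r'"
    unfolding r'_def by (rule eqv_linear) (simp add: algebra_simps)
  finally have r': "Plus (Scale (\<alpha> h) s) (Scale (- \<gamma> h) s) \<approx> r'" .
  have "other_wts \<alpha> n r'"
    unfolding r'_def by (rule other_wts_ad[OF *(2,4)])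
  moreover have "wt \<alpha> r'"
    by (rule wt_eqv[OF _ r']) (intro wt_plus wt_scale Suc.prems)
  ultimately have "r' \<approx> Zero" by (rule Suc.IH)
  have "Scale (\<alpha> h - \<gamma> h) s \<approx> Plus (Scale (\<alpha> h) s) (Scale (- \<gamma> h) s)"
    by (rule eqv_linear) (simp add: algebra_simps)
  also note r'
  also note \<open>r' \<approx> Zero\<close>
  finally show ?case by (rule eqv_scale_zero) (use * in simp)
qed

lemma lspan_split:
  assumes "t \<in> lspan A" and "\<And>a. a \<in> A \<Longrightarrow> \<exists>\<gamma>. wt \<gamma> a"
  shows "\<exists>s r n. t \<approx> Plus s r \<and> s \<in> lspan {a\<in>A. wt \<alpha> a} \<and> other_wts \<alpha> n r"
  using assms(1)
proof (induction rule: lspan.induct)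
  case (lspan_base t)
  show ?case
  proof (cases "wt \<alpha> t")
    case True
    have "t \<approx> Plus t Zero" by (rule eqv_linear) simp
    moreover have "other_wts \<alpha> 0 Zero" by simp
    moreover have "t \<in> lspan {a\<in>A. wt \<alpha> a}"
      by (rule lspan.lspan_base) (simp add: True lspan_base)
    ultimately show ?thesis by blast
  next
    case False
    obtain \<gamma> where \<gamma>: "wt \<gamma> t" using assms lspan_base by blast
    with False obtain h where "h \<in> hspace v" "\<gamma> h \<noteq> \<alpha> h" unfolding wt_def by force
    moreover have "t \<approx> Plus t Zero" by (rule eqv_linear) simp
    ultimately have "other_wts \<alpha> (Suc 0) t" using \<gamma> by (intro other_wts_SucI) simp_all
    moreover have "t \<approx> Plus Zero t" by (rule eqv_linear) simp
    ultimately show ?thesis using lspan.lspan_zero by blast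
  qed
next
  case lspan_zero
  have "Zero \<approx> Plus Zero Zero" by (rule eqv_linear) simp
  moreover have "other_wts \<alpha> 0 Zero" by simp
  ultimately show ?case using lspan.lspan_zero by blast
next
  case (lspan_plus s t)
  then obtain s1 r1 m s2 r2 n where
    *: "s \<approx> Plus s1 r1" "s1 \<in> lspan {a\<in>A. wt \<alpha> a}" "other_wts \<alpha> m r1"
       "t \<approx> Plus s2 r2" "s2 \<in> lspan {a\<in>A. wt \<alpha> a}" "other_wts \<alpha> n r2" by blast
  have "Plus s t \<approx> Plus (Plus s1 r1) (Plus s2 r2)" by (intro eqv_plus *)
  also have "\<dots> \<approx> Plus (Plus s1 s2) (Plus r1 r2)" by (rule eqv_linear) (simp add: algebra_simps)
  finally show ?case
    using lspan.lspan_plus[OF *(2,5)] other_wts_plus[OF *(3,6)] by blast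
next
  case (lspan_scale s c)
  then obtain s1 r1 m where
    *: "s \<approx> Plus s1 r1" "s1 \<in> lspan {a\<in>A. wt \<alpha> a}" "other_wts \<alpha> m r1" by blast
  have "Scale c s \<approx> Scale c (Plus s1 r1)" by (intro eqv_scale *)
  also have "\<dots> \<approx> Plus (Scale c s1) (Scale c r1)" by (rule eqv_linear) (simp add: algebra_simps)
  finally show ?case
    using lspan.lspan_scale[OF *(2)] other_wts_scale[OF *(3)] by blast
next
  case (lspan_eqv s t)
  then show ?case using eqv_trans[OF eqv_sym[OF lspan_eqv.hyps(2)]] lspan_eqv.IH by blast
qed

text \<open>Split \<open>t\<close> into a part \<open>s\<close> spanned by elements of weight
  \<open>\<alpha>\<close> and a remainder of other weights. The remainder equals
  \<open>t - s\<close>, so it also has weight \<open>\<alpha>\<close> and must vanish.\<close>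

lemma wt_vector_in_lspan:
  assumes "t \<in> lspan A" and "\<And>a. a \<in> A \<Longrightarrow> \<exists>\<gamma>. wt \<gamma> a" and "wt \<alpha> t"
  shows "t \<in> lspan {a\<in>A. wt \<alpha> a}"
proof -
  obtain s r n where *: "t \<approx> Plus s r" "s \<in> lspan {a\<in>A. wt \<alpha> a}" "other_wts \<alpha> n r"
    using lspan_split[OF assms(1,2)] by blast
  have "wt \<alpha> s" by (rule wt_lspan[OF *(2)]) simp
  have "Plus t (Scale (-1) s) \<approx> Plus (Plus s r) (Scale (-1) s)"
    by (intro eqv_plus eqv_refl *)
  also have "\<dots> \<approx> r" by (rule eqv_linear) simp
  finally have "Plus t (Scale (-1) s) \<approx> r" .
  then have "wt \<alpha> r"
    by (rule wt_eqv[rotated]) (intro wt_plus wt_scale assms \<open>wt \<alpha> s\<close>)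
  with *(3) have "r \<approx> Zero" by (rule other_wts_zero)
  then have "Plus s r \<approx> Plus s Zero" by (intro eqv_plus eqv_refl)
  also have "\<dots> \<approx> s" by (rule eqv_linear) simp
  finally show ?thesis using *(2) by (rule lspan_eqv'[OF eqv_trans[OF *(1)]])
qed

end

section \<open>Triangular decomposition\<close>

text \<open>The boolean sign lets one argument serve raising and lowering generators;
  \<open>sgnb\<close> is the sign of the corresponding weight.\<close>

definition gen :: "bool \<Rightarrow> 'x \<Rightarrow> ('h, 'x) lie_term" where
  "gen \<sigma> x = (if \<sigma> then E x else F x)"

definition sgnb :: "bool \<Rightarrow> complex" where
  "sgnb \<sigma> = (if \<sigma> then 1 else -1)"

text \<open>Right-normed brackets of generators of one sign; \<open>n\<close> counts how often each
  letter occurs and so determines the weight.\<close>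

inductive word :: "bool \<Rightarrow> ('x \<Rightarrow> nat) \<Rightarrow> ('h, 'x) lie_term \<Rightarrow> bool" for \<sigma> where
  word_gen: "word \<sigma> (\<lambda>y. of_bool (y = x)) (gen \<sigma> x)"
| word_bracket: "word \<sigma> n t \<Longrightarrow> word \<sigma> (\<lambda>y. of_bool (y = x) + n y) (Bracket (gen \<sigma> x) t)"

lemma word_height:
  fixes n :: "'x::finite \<Rightarrow> nat"
  shows "word \<sigma> n t \<Longrightarrow> sum n UNIV \<ge> 1"
  by (induction rule: word.induct) (simp_all add: sum.distrib)

text \<open>A bracket contains at least two letters, so the content of a single letter leaves only
  the generator. This bounds the weight space of a simple root by dimension one.\<close>

lemma word_simple:
  fixes y :: "'x::finite"
  assumes "word \<sigma> n t" and "n = (\<lambda>z. of_bool (z = y))"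
  shows "t = gen \<sigma> y"
  using assms(1)
proof cases
  case (word_gen x)
  with assms(2) have "(\<lambda>z. of_bool (z = x)) = (\<lambda>z. of_bool (z = y) :: nat)"
    by simp
  from fun_cong[OF this, of x] have "x = y"
    by (cases "x = y") simp_all
  with word_gen show ?thesis by simp
next
  case (word_bracket m s x)
  have "sum n UNIV = 1"
    using assms(2) by simp
  moreover have "sum n UNIV \<ge> 2"
    using word_bracket word_height[of \<sigma> m s] by (simp add: sum.distrib)
  ultimately show ?thesis by simp
qed

lemma bvec_independent:
  fixes v :: "('h::complex_vector, 'x::finite) root_datum"
  assumes "is_root_datum v"
    and "\<And>t. t \<in> hspace v \<Longrightarrow> (\<Sum>x\<in>UNIV. c x * bvec v x t) = (\<Sum>x\<in>UNIV. d x * bvec v x t)"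
  shows "c = d"
proof -
  have "\<forall>t\<in>hspace v. (\<Sum>x\<in>UNIV. (c x - d x) * bvec v x t) = 0"
    using assms(2) by (simp add: algebra_simps sum_subtractf)
  moreover have "\<forall>c. (\<forall>t\<in>hspace v. (\<Sum>x\<in>UNIV. c x * bvec v x t) = 0) \<longrightarrow> (\<forall>x. c x = 0)"
    using assms(1) by (simp add: is_root_datum_def)
  ultimately have "\<forall>x. c x - d x = 0"
    by (auto dest: spec[of _ "\<lambda>x. c x - d x"])
  then show ?thesis by auto
qed

lemma avec_nonzero:
  fixes v :: "('h::complex_vector, 'x::finite) root_datum"
  assumes "is_root_datum v"
  shows "avec v x \<noteq> 0"
proof
  assume "avec v x = 0"
  then have "(\<Sum>y\<in>UNIV. of_bool (y = x) *\<^sub>C avec v y) = 0"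
    by (intro sum.neutral) auto
  moreover have "\<forall>c. (\<Sum>x\<in>UNIV. c x *\<^sub>C avec v x) = 0 \<longrightarrow> (\<forall>x. c x = 0)"
    using assms by (simp add: is_root_datum_def)
  ultimately have "\<forall>y. of_bool (y = x) = (0 :: complex)"
    by (auto dest: spec[of _ "\<lambda>y. of_bool (y = x)"])
  then show False by (auto dest: spec[of _ x])
qed

context hb_quotient
begin

lemma avec_hspace: "avec v x \<in> hspace v"
  using root_datum by (simp add: is_root_datum_def)

lemma homogeneous_gen: "homogeneous v (par v x) (gen \<sigma> x)"
  by (simp add: gen_def homogeneous.intros)

lemma wt_gen: "wt (\<lambda>h. sgnb \<sigma> * bvec v x h) (gen \<sigma> x)"
  unfolding wt_def by (cases \<sigma>) (auto simp: gen_def sgnb_def intro!: eqv_hb hb_cartan_E hb_cartan_F)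

lemma wt_word: "word \<sigma> n t \<Longrightarrow> wt (\<lambda>h. sgnb \<sigma> * (\<Sum>y\<in>UNIV. of_nat (n y) * bvec v y h)) t"
proof (induction rule: word.induct)
  case (word_gen x)
  have "(\<lambda>h. sgnb \<sigma> * (\<Sum>y\<in>UNIV. of_nat (of_bool (y = x)) * bvec v y h)) = (\<lambda>h. sgnb \<sigma> * bvec v x h)"
    by (simp add: if_distrib cong: if_cong)
  then show ?case using wt_gen[of \<sigma> x] by simp
next
  case (word_bracket n t x)
  have "(\<lambda>h. sgnb \<sigma> * (\<Sum>y\<in>UNIV. of_nat (of_bool (y = x) + n y) * bvec v y h)) =
      (\<lambda>h. sgnb \<sigma> * bvec v x h + sgnb \<sigma> * (\<Sum>y\<in>UNIV. of_nat (n y) * bvec v y h))"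
    by (simp add: algebra_simps sum.distrib if_distrib cong: if_cong)
  then show ?case
    using wt_bracket[OF wt_gen word_bracket.IH homogeneous_gen, of \<sigma> x] by simp
qed

lemma wt_cartan: "h \<in> hspace v \<Longrightarrow> wt (\<lambda>h. 0) (Cartan h)"
  unfolding wt_def
proof
  fix k assume "h \<in> hspace v" "k \<in> hspace v"
  then have "Bracket (Cartan k) (Cartan h) \<approx> Zero"
    by (intro eqv_hb hb_cartan_comm)
  also have "\<dots> \<approx> Scale 0 (Cartan h)"
    by (rule eqv_linear) simp
  finally show "Bracket (Cartan k) (Cartan h) \<approx> Scale 0 (Cartan h)" .
qed

lemma bracket_gen_cartan:
  assumes "h \<in> hspace v"
  shows "\<exists>c. Bracket (gen \<sigma> x) (Cartan h) \<approx> Scale c (gen \<sigma> x)"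
proof -
  have "Bracket (gen \<sigma> x) (Cartan h) \<approx> Scale (- koszul (par v x) 0) (Bracket (Cartan h) (gen \<sigma> x))"
    by (intro eqv_hb hb_skew homogeneous_gen homogeneous.intros)
  also have "\<dots> \<approx> Scale (- koszul (par v x) 0) (Scale (sgnb \<sigma> * bvec v x h) (gen \<sigma> x))"
    using wt_gen assms by (intro eqv_scale) (simp add: wt_def)
  also have "\<dots> \<approx> Scale (- koszul (par v x) 0 * (sgnb \<sigma> * bvec v x h)) (gen \<sigma> x)"
    by (rule eqv_linear) simp
  finally show ?thesis by blast
qed

lemma bracket_opposite_gens:
  "\<exists>c. Bracket (gen \<sigma> x) (gen (\<not> \<sigma>) y) \<approx> Scale c (Cartan (avec v x))"
proof -
  have EF: "\<exists>c. Bracket (E z) (F z') \<approx> Scale c (Cartan (avec v z)) \<and> (z \<noteq> z' \<longrightarrow> c = 0)" for z z'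
  proof (cases "z = z'")
    case True
    have "Bracket (E z) (F z) \<approx> Cartan (avec v z)" by (intro eqv_hb hb_E_F_same)
    also have "\<dots> \<approx> Scale 1 (Cartan (avec v z))" by (rule eqv_linear) simp
    finally show ?thesis using True by blast
  next
    case False
    then have "Bracket (E z) (F z') \<approx> Zero" by (intro eqv_hb hb_E_F_diff)
    also have "\<dots> \<approx> Scale 0 (Cartan (avec v z))" by (rule eqv_linear) simp
    finally show ?thesis by blast
  qed
  show ?thesis
  proof (cases \<sigma>)
    case True
    then show ?thesis using EF[of x y] by (auto simp: gen_def)
  next
    case False
    obtain c where c: "Bracket (E y) (F x) \<approx> Scale c (Cartan (avec v y))" "y \<noteq> x \<longrightarrow> c = 0"
      using EF by blast
    have "Bracket (F x) (E y) \<approx> Scale (- koszul (par v x) (par v y)) (Bracket (E y) (F x))"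
      by (intro eqv_hb hb_skew homogeneous.intros)
    also have "\<dots> \<approx> Scale (- koszul (par v x) (par v y)) (Scale c (Cartan (avec v y)))"
      by (intro eqv_scale c)
    \<comment> \<open>If \<open>y\<close> differs from \<open>x\<close> then \<open>c = 0\<close>,
      so the coroot may be relabelled from \<open>y\<close> to \<open>x\<close> in either
      case.\<close>
    also have "\<dots> \<approx> Scale (- koszul (par v x) (par v y) * c) (Cartan (avec v x))"
      using c(2) by (intro eqv_linear) (cases "y = x"; simp add: mult.assoc)
    finally show ?thesis using False by (auto simp: gen_def)
  qed
qed

section \<open>Stability of the triangular span under brackets\<close>

definition borel :: "bool \<Rightarrow> ('h, 'x) lie_term set" where
  "borel \<sigma> = Cartan ` hspace v \<union> {t. \<exists>n. word \<sigma> n t}"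

lemma borel_wt:
  assumes "a \<in> borel \<sigma>"
  obtains h where "a = Cartan h" "h \<in> hspace v" "wt (\<lambda>h. 0) a"
  | n where "word \<sigma> n a" "wt (\<lambda>h. sgnb \<sigma> * (\<Sum>y\<in>UNIV. of_nat (n y) * bvec v y h)) a"
  using assms wt_cartan wt_word unfolding borel_def by blast

lemma cartan_bracket_borel:
  assumes "h \<in> hspace v" "a \<in> borel \<sigma>"
  shows "Bracket (Cartan h) a \<in> lspan (borel \<sigma>)"
proof -
  obtain \<gamma> where "wt \<gamma> a"
    using assms(2) by (rule borel_wt)
  then have "Bracket (Cartan h) a \<approx> Scale (\<gamma> h) a"
    using assms(1) by (simp add: wt_def)
  then show ?thesis
    by (rule lspan_eqv'[OF _ lspan_scale[OF lspan_base[OF assms(2)]]])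
qed

lemma gen_bracket_borel_same:
  assumes "a \<in> borel \<sigma>"
  shows "Bracket (gen \<sigma> x) a \<in> lspan (borel \<sigma>)"
  using assms
proof (rule borel_wt)
  fix h assume "a = Cartan h" "h \<in> hspace v"
  then obtain c where "Bracket (gen \<sigma> x) a \<approx> Scale c (gen \<sigma> x)"
    using bracket_gen_cartan by blast
  moreover have "gen \<sigma> x \<in> borel \<sigma>"
    using word_gen by (force simp: borel_def)
  ultimately show ?thesis
    by (rule lspan_eqv'[OF _ lspan_scale[OF lspan_base]])
next
  fix n assume "word \<sigma> n a"
  then have "Bracket (gen \<sigma> x) a \<in> borel \<sigma>"
    using word_bracket by (force simp: borel_def)
  then show ?thesis by (rule lspan_base)
qed

text \<open>The Jacobi identity moves the generator past the first letter \<open>y\<close>. The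
  commutator with that letter is a multiple of a coroot and acts by a scalar on the rest, while the
  remaining term is \<open>gen (\<not> \<sigma>) y\<close> applied to the induction
  hypothesis.\<close>

lemma gen_bracket_opposite_word:
  "word (\<not> \<sigma>) n t \<Longrightarrow> Bracket (gen \<sigma> x) t \<in> lspan (borel (\<not> \<sigma>))"
proof (induction rule: word.induct)
  case (word_gen y)
  obtain c where "Bracket (gen \<sigma> x) (gen (\<not> \<sigma>) y) \<approx> Scale c (Cartan (avec v x))"
    using bracket_opposite_gens by blast
  moreover have "Cartan (avec v x) \<in> borel (\<not> \<sigma>)"
    using avec_hspace by (simp add: borel_def)
  ultimately show ?case
    by (rule lspan_eqv'[OF _ lspan_scale[OF lspan_base]])
next
  case (word_bracket n t y)
  have t: "t \<in> borel (\<not> \<sigma>)"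
    using word_bracket.hyps by (auto simp: borel_def)
  obtain c where c: "Bracket (gen \<sigma> x) (gen (\<not> \<sigma>) y) \<approx> Scale c (Cartan (avec v x))"
    using bracket_opposite_gens by blast
  have "Bracket (Bracket (gen \<sigma> x) (gen (\<not> \<sigma>) y)) t \<approx> Bracket (Scale c (Cartan (avec v x))) t"
    by (rule eqv_bracket_left[OF c])
  also have "\<dots> \<approx> Scale c (Bracket (Cartan (avec v x)) t)"
    by (rule bracket_scale_left)
  finally have "Bracket (Bracket (gen \<sigma> x) (gen (\<not> \<sigma>) y)) t \<in> lspan (borel (\<not> \<sigma>))"
    by (rule lspan_eqv'[OF _ lspan_scale[OF cartan_bracket_borel[OF avec_hspace t]]])
  moreover have "Bracket (gen (\<not> \<sigma>) y) (Bracket (gen \<sigma> x) t) \<in> lspan (borel (\<not> \<sigma>))"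
    by (rule lspan_bracket[OF word_bracket.IH gen_bracket_borel_same])
  ultimately show ?case
    by (rule lspan_eqv'[OF jacobi[OF homogeneous_gen homogeneous_gen] lspan_plus[OF _ lspan_scale]])
qed

definition triangular :: "('h, 'x) lie_term set" where
  "triangular = borel True \<union> borel False"

lemma borel_subset: "borel \<sigma> \<subseteq> triangular"
  by (cases \<sigma>) (auto simp: triangular_def)

lemma gen_bracket_triangular:
  assumes "a \<in> triangular"
  shows "Bracket (gen \<sigma> x) a \<in> lspan triangular"
proof -
  \<comment> \<open>Cartan elements lie in both halves; they are assigned to the half of the acting
    generator, because the bracket is a multiple of that generator.\<close>
  have "a \<in> borel \<sigma> \<or> (\<exists>n. word (\<not> \<sigma>) n a)"
    using assms by (cases \<sigma>) (auto simp: triangular_def borel_def)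
  then show ?thesis
  proof
    assume "a \<in> borel \<sigma>"
    then show ?thesis
      by (rule lspan_mono[OF gen_bracket_borel_same borel_subset])
  next
    assume "\<exists>n. word (\<not> \<sigma>) n a"
    then obtain n where "word (\<not> \<sigma>) n a" ..
    then show ?thesis
      by (rule lspan_mono[OF gen_bracket_opposite_word borel_subset])
  qed
qed

lemma cartan_bracket_triangular:
  assumes "h \<in> hspace v" "a \<in> triangular"
  shows "Bracket (Cartan h) a \<in> lspan triangular"
proof -
  obtain \<sigma> where "a \<in> borel \<sigma>"
    using assms(2) by (auto simp: triangular_def)
  then show ?thesis
    by (rule lspan_mono[OF cartan_bracket_borel[OF assms(1)] borel_subset])
qed

lemma gen_triangular: "gen \<sigma> x \<in> triangular"
proof -
  have "gen \<sigma> x \<in> borel \<sigma>"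
    using word_gen by (force simp: borel_def)
  then show ?thesis using borel_subset by blast
qed

text \<open>It is enough that generators preserve the span, since \<open>ad\<close> of a bracket is
  the supercommutator of the two \<open>ad\<close> maps. Keeping \<open>t\<close> arbitrary in the
  induction allows these maps to be applied one after the other.\<close>

lemma homogeneous_bracket_triangular:
  "homogeneous v i s \<Longrightarrow> t \<in> lspan triangular \<Longrightarrow> Bracket s t \<in> lspan triangular"
proof (induction arbitrary: t rule: homogeneous.induct)
  case (1 h)
  show ?case
  proof (cases "h \<in> hspace v")
    case True
    then show ?thesis by (intro lspan_bracket[OF 1] cartan_bracket_triangular)
  next
    case False
    then have "Bracket (Cartan h) t \<approx> Bracket Zero t"
      by (intro eqv_bracket_left eqv_hb hb_outside)
    also have "\<dots> \<approx> Zero" by (rule bracket_zero_left)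
    finally show ?thesis by (rule lspan_eqv'[OF _ lspan_zero])
  qed
next
  case (2 x)
  then show ?case
    using lspan_bracket[OF _ gen_bracket_triangular[of _ True x]] by (simp add: gen_def)
next
  case (3 x)
  then show ?case
    using lspan_bracket[OF _ gen_bracket_triangular[of _ False x]] by (simp add: gen_def)
next
  case (4 i)
  show ?case by (rule lspan_eqv'[OF bracket_zero_left lspan_zero])
next
  case (5 i s s')
  show ?case by (rule lspan_eqv'[OF bracket_plus_left lspan_plus]) (rule 5)+
next
  case (6 i s c)
  show ?case by (rule lspan_eqv'[OF bracket_scale_left lspan_scale]) (rule 6)+
next
  case (7 i s j s')
  \<comment> \<open>The Jacobi identity solved for \<open>[[s, s'], t]\<close>.\<close>
  have "Bracket (Bracket s s') t \<approx>
      Plus (Plus (Bracket (Bracket s s') t) (Scale (koszul i j) (Bracket s' (Bracket s t))))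
        (Scale (- koszul i j) (Bracket s' (Bracket s t)))"
    by (rule eqv_linear) simp
  also have "\<dots> \<approx> Plus (Bracket s (Bracket s' t)) (Scale (- koszul i j) (Bracket s' (Bracket s t)))"
    by (rule eqv_plus[OF eqv_sym[OF jacobi[OF 7(1,2)]] eqv_refl])
  finally show ?case
    by (rule lspan_eqv'[OF _ lspan_plus[OF _ lspan_scale]]) (intro 7)+
qed

lemma homogeneous_triangular: "homogeneous v i s \<Longrightarrow> s \<in> lspan triangular"
proof (induction rule: homogeneous.induct)
  case (1 h)
  show ?case
  proof (cases "h \<in> hspace v")
    case True
    then show ?thesis by (intro lspan_base) (simp add: triangular_def borel_def)
  next
    case False
    then show ?thesis by (intro lspan_eqv'[OF eqv_hb[OF hb_outside] lspan_zero])
  qed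
next
  case (2 x)
  then show ?case using lspan_base[OF gen_triangular[of True x]] by (simp add: gen_def)
next
  case (3 x)
  then show ?case using lspan_base[OF gen_triangular[of False x]] by (simp add: gen_def)
qed (auto intro: lspan_zero lspan_plus lspan_scale homogeneous_bracket_triangular)

section \<open>Weights occurring in the quotient\<close>

lemma wt_unique:
  assumes "wt \<gamma> a" "wt \<delta> a" "a \<notin> I" "h \<in> hspace v"
  shows "\<gamma> h = \<delta> h"
proof (rule ccontr)
  assume "\<gamma> h \<noteq> \<delta> h"
  have "Scale (\<gamma> h) a \<approx> Bracket (Cartan h) a"
    by (rule eqv_sym) (use assms in \<open>simp add: wt_def\<close>)
  also have "\<dots> \<approx> Scale (\<delta> h) a"
    using assms by (simp add: wt_def)
  finally have "Scale (\<gamma> h) a \<approx> Scale (\<delta> h) a" .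
  then have "Plus (Scale (\<gamma> h) a) (Scale (- \<delta> h) a) \<approx> Plus (Scale (\<delta> h) a) (Scale (- \<delta> h) a)"
    by (intro eqv_plus eqv_refl)
  also have "\<dots> \<approx> Zero" by (rule eqv_linear) simp
  finally have *: "Plus (Scale (\<gamma> h) a) (Scale (- \<delta> h) a) \<approx> Zero" .
  have "Scale (\<gamma> h - \<delta> h) a \<approx> Plus (Scale (\<gamma> h) a) (Scale (- \<delta> h) a)"
    by (rule eqv_linear) (simp add: algebra_simps)
  also note *
  finally have "a \<approx> Zero" by (rule eqv_scale_zero) (use \<open>\<gamma> h \<noteq> \<delta> h\<close> in simp)
  with assms(3) show False by (simp add: eqv_zero_iff)
qed

text \<open>Discarding spanning elements that vanish in the quotient leaves elements outside
  \<open>I\<close>, for which \<open>wt_unique\<close> applies.\<close>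

lemma lspan_diff_ideal:
  assumes "t \<in> lspan A"
  shows "t \<in> lspan (A - I)"
  using assms
proof (induction rule: lspan.induct)
  case (lspan_base t)
  show ?case
  proof (cases "t \<in> I")
    case True
    then have "t \<approx> Zero" by (simp add: eqv_zero_iff)
    then show ?thesis by (rule lspan_eqv'[OF _ lspan.lspan_zero])
  qed (use lspan_base in \<open>auto intro: lspan.lspan_base\<close>)
next
  case (lspan_eqv s t)
  show ?case by (rule lspan.lspan_eqv[OF lspan_eqv.IH lspan_eqv.hyps(2)])
qed (auto intro: lspan.lspan_zero lspan.lspan_plus lspan.lspan_scale)

lemma triangular_wt: "a \<in> triangular \<Longrightarrow> \<exists>\<gamma>. wt \<gamma> a"
  unfolding triangular_def by (auto elim: borel_wt)

lemma homogeneous_wt_vector: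
  assumes "homogeneous v i t" "wt \<alpha> t"
  shows "t \<in> lspan {a \<in> triangular - I. wt \<alpha> a}"
  using wt_vector_in_lspan[OF lspan_diff_ideal[OF homogeneous_triangular[OF assms(1)]] _ assms(2)]
    triangular_wt by blast

text \<open>A nonzero \<open>t\<close> cannot be a combination of the empty set, so some spanning
  element outside \<open>I\<close> has weight \<open>\<alpha>\<close>. Being a Cartan element or a
  word, it also shows its weight explicitly.\<close>

lemma weight_cases:
  assumes "homogeneous v i t" "wt \<alpha> t" "t \<notin> I"
  obtains "\<And>h. h \<in> hspace v \<Longrightarrow> \<alpha> h = 0"
  | \<sigma> n where "\<And>h. h \<in> hspace v \<Longrightarrow> \<alpha> h = sgnb \<sigma> * (\<Sum>y\<in>UNIV. of_nat (n y) * bvec v y h)"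
proof -
  have "{a \<in> triangular - I. wt \<alpha> a} \<noteq> {}"
  proof
    assume "{a \<in> triangular - I. wt \<alpha> a} = {}"
    with homogeneous_wt_vector[OF assms(1,2)] have "t \<in> lspan {}" by (simp only:)
    then have "t \<approx> Zero" by (rule lspan_empty)
    with assms(3) show False by (simp add: eqv_zero_iff)
  qed
  then obtain a where a: "a \<in> triangular" "a \<notin> I" "wt \<alpha> a" by blast
  then obtain \<sigma> where "a \<in> borel \<sigma>" by (auto simp: triangular_def)
  then show ?thesis
  proof (rule borel_wt)
    assume "wt (\<lambda>h. 0) a"
    then show ?thesis using wt_unique[OF a(3) _ a(2)] that(1) by blast
  next
    fix n assume "wt (\<lambda>h. sgnb \<sigma> * (\<Sum>y\<in>UNIV. of_nat (n y) * bvec v y h)) a"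
    then show ?thesis using wt_unique[OF a(3) _ a(2)] that(2) by blast
  qed
qed

text \<open>By independence of the \<open>b_v(z)\<close>, the only spanning element outside
  \<open>I\<close> that can have this weight is the generator itself.\<close>

lemma simple_root_vector:
  assumes "homogeneous v i t" "wt (\<lambda>h. sgnb \<tau> * bvec v y h) t"
  shows "\<exists>c. t \<approx> Scale c (gen \<tau> y)"
proof -
  have "a = gen \<tau> y" if a: "a \<in> triangular" "a \<notin> I" "wt (\<lambda>h. sgnb \<tau> * bvec v y h) a" for a
  proof -
    have single: "(\<Sum>z\<in>UNIV. sgnb \<tau> * (of_bool (z = y) * bvec v z h)) = sgnb \<tau> * bvec v y h" for h
      by (subst sum.remove[of _ y]) (auto intro!: sum.neutral)
    obtain \<sigma> where "a \<in> borel \<sigma>" using a by (auto simp: triangular_def)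
    then show ?thesis
    proof (rule borel_wt)
      assume "wt (\<lambda>h. 0) a"
      then have "sgnb \<tau> * bvec v y h = 0" if "h \<in> hspace v" for h
        using wt_unique[OF a(3) _ a(2) that] by simp
      then have "(\<lambda>z. sgnb \<tau> * of_bool (z = y)) = (\<lambda>z. 0)"
        by (intro bvec_independent[OF root_datum]) (simp add: single mult.assoc)
      then show ?thesis by (auto simp: fun_eq_iff sgnb_def split: if_splits)
    next
      fix n assume w: "word \<sigma> n a"
      assume "wt (\<lambda>h. sgnb \<sigma> * (\<Sum>y\<in>UNIV. of_nat (n y) * bvec v y h)) a"
      then have "sgnb \<tau> * bvec v y h = sgnb \<sigma> * (\<Sum>y\<in>UNIV. of_nat (n y) * bvec v y h)"
        if "h \<in> hspace v" for h
        using wt_unique[OF a(3) _ a(2) that] by simp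
      then have "(\<lambda>z. sgnb \<tau> * of_bool (z = y)) = (\<lambda>z. sgnb \<sigma> * of_nat (n z))"
        by (intro bvec_independent[OF root_datum]) (simp add: single sum_distrib_left mult.assoc)
      then have *: "sgnb \<tau> * of_bool (z = y) = sgnb \<sigma> * of_nat (n z)" for z
        by (rule fun_cong)
      have "\<tau> = \<sigma>"
      proof (rule ccontr)
        assume "\<tau> \<noteq> \<sigma>"
        then have "sgnb \<tau> = - sgnb \<sigma>" "sgnb \<sigma> \<noteq> 0"
          by (auto simp: sgnb_def)
        \<comment> \<open>With opposite signs the coefficients at \<open>y\<close> are
          \<open>-sgnb \<sigma>\<close> and \<open>sgnb \<sigma> * n y\<close>; moving both to one
          side gives the factor \<open>1 + n y\<close>, which is positive.\<close>
        then have "sgnb \<sigma> * of_nat (Suc (n y)) = 0"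
          by (simp add: distrib_left *[of y, symmetric])
        with \<open>sgnb \<sigma> \<noteq> 0\<close> have "of_nat (Suc (n y)) = (0 :: complex)"
          by (simp only: mult_eq_0_iff) blast
        then show False by (simp only: of_nat_eq_0_iff)
      qed
      then have "of_nat (n z) = (of_nat (of_bool (z = y)) :: complex)" for z
        using *[of z] by (cases \<sigma>) (simp_all add: sgnb_def)
      then have "n z = of_bool (z = y)" for z
        by (simp only: of_nat_eq_iff)
      then have "a = gen \<sigma> y" by (intro word_simple[OF w]) auto
      with \<open>\<tau> = \<sigma>\<close> show ?thesis by simp
    qed
  qed
  then have "t \<in> lspan {gen \<tau> y}"
    using lspan_mono[OF homogeneous_wt_vector[OF assms]] by blast
  then show ?thesis by (rule lspan_singleton)
qed

end

section \<open>Comparison of two vertices of an admissible component\<close>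

text \<open>The isomorphism goes from the algebra at \<open>u\<close> to the one at
  \<open>v\<close>. Arrows inside a skeleton induce the identity of the common space, whence
  \<open>iso_cartan\<close>.\<close>

locale hb_quotient_iso =
  src: hb_quotient u J + hb_quotient v I
  for u v :: "('h::complex_vector, 'x::finite) root_datum" and I J +
  fixes \<phi> :: "('h, 'x) lie_term \<Rightarrow> ('h, 'x) lie_term"
  assumes hspace_eq: "hspace u = hspace v"
    and iso: "superalgebra_iso u J v I \<phi>"
    and iso_cartan: "\<And>h. h \<in> hspace v \<Longrightarrow> \<phi> (Cartan h) \<approx> Cartan h"
    and cartan_injective: "\<And>h. h \<in> hspace v \<Longrightarrow> Cartan h \<in> I \<Longrightarrow> h = 0"
begin

lemma iso_eqv: "quot_eq J s t \<Longrightarrow> \<phi> s \<approx> \<phi> t"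
  and iso_scale: "\<phi> (Scale c s) \<approx> Scale c (\<phi> s)"
  and iso_bracket: "\<phi> (Bracket s t) \<approx> Bracket (\<phi> s) (\<phi> t)"
  and iso_homogeneous: "homogeneous u i s \<Longrightarrow> \<exists>t. homogeneous v i t \<and> \<phi> s \<approx> t"
  using iso by (simp_all add: superalgebra_iso_def)

lemma iso_wt:
  assumes "src.wt \<gamma> t"
  shows "wt \<gamma> (\<phi> t)"
  unfolding wt_def
proof
  fix h assume h: "h \<in> hspace v"
  have "Bracket (Cartan h) (\<phi> t) \<approx> Bracket (\<phi> (Cartan h)) (\<phi> t)"
    by (rule eqv_bracket_left[OF eqv_sym[OF iso_cartan[OF h]]])
  also have "\<dots> \<approx> \<phi> (Bracket (Cartan h) t)"
    by (rule eqv_sym[OF iso_bracket])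
  also have "\<dots> \<approx> \<phi> (Scale (\<gamma> h) t)"
    using assms h by (intro iso_eqv) (simp add: src.wt_def hspace_eq)
  also have "\<dots> \<approx> Scale (\<gamma> h) (\<phi> t)"
    by (rule iso_scale)
  finally show "Bracket (Cartan h) (\<phi> t) \<approx> Scale (\<gamma> h) (\<phi> t)" .
qed

text \<open>The image of a generator is only congruent to a homogeneous term; the representative
  \<open>t\<close> is needed because the weight results are about homogeneous terms.\<close>

lemma iso_gen:
  obtains i t where "homogeneous v i t" "wt (\<lambda>h. sgnb \<sigma> * bvec u x h) t" "\<phi> (gen \<sigma> x) \<approx> t"
proof -
  obtain t where t: "homogeneous v (par u x) t" "\<phi> (gen \<sigma> x) \<approx> t"
    using iso_homogeneous[OF src.homogeneous_gen] by blast
  then show ?thesis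
    by (intro that[OF t(1) wt_eqv[OF iso_wt[OF src.wt_gen] t(2)] t(2)])
qed

lemma iso_coroot:
  "Bracket (\<phi> (E x)) (\<phi> (F x)) \<approx> Cartan (avec u x)"
proof -
  have "Bracket (\<phi> (E x)) (\<phi> (F x)) \<approx> \<phi> (Bracket (E x) (F x))"
    by (rule eqv_sym[OF iso_bracket])
  also have "\<dots> \<approx> \<phi> (Cartan (avec u x))"
    by (rule iso_eqv[OF src.eqv_hb[OF hb_E_F_same]])
  also have "\<dots> \<approx> Cartan (avec u x)"
    using src.avec_hspace hspace_eq by (intro iso_cartan) simp
  finally show ?thesis .
qed

theorem simple_root_coordinates:
  "\<exists>n. (\<forall>h\<in>hspace v. bvec u x h = (\<Sum>y\<in>UNIV. of_nat (n y) * bvec v y h)) \<or>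
       (\<forall>h\<in>hspace v. bvec u x h = - (\<Sum>y\<in>UNIV. of_nat (n y) * bvec v y h))"
proof -
  obtain i t where t: "homogeneous v i t" "wt (\<lambda>h. sgnb True * bvec u x h) t" "\<phi> (gen True x) \<approx> t"
    by (rule iso_gen)
  have "t \<notin> I"
  proof
    assume "t \<in> I"
    then have "t \<approx> Zero" by (simp add: eqv_zero_iff)
    have "\<phi> (E x) \<approx> t" using t(3) by (simp add: gen_def)
    also note \<open>t \<approx> Zero\<close>
    finally have "Bracket (\<phi> (E x)) (\<phi> (F x)) \<approx> Bracket Zero (\<phi> (F x))"
      by (rule eqv_bracket_left)
    also have "\<dots> \<approx> Zero" by (rule bracket_zero_left)
    finally have "Cartan (avec u x) \<approx> Zero"
      by (rule eqv_trans[OF eqv_sym[OF iso_coroot]])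
    then have "avec u x = 0"
      using cartan_injective src.avec_hspace hspace_eq by (simp add: eqv_zero_iff)
    then show False using avec_nonzero[OF src.root_datum] by simp
  qed
  from t(1,2) this show ?thesis
  proof (rule weight_cases)
    assume "\<And>h. h \<in> hspace v \<Longrightarrow> sgnb True * bvec u x h = 0"
    \<comment> \<open>Weight zero is the combination with all coefficients zero.\<close>
    then show ?thesis by (intro exI[of _ "\<lambda>y. 0"]) (simp add: sgnb_def)
  next
    fix \<sigma> n
    assume "\<And>h. h \<in> hspace v \<Longrightarrow> sgnb True * bvec u x h = sgnb \<sigma> * (\<Sum>y\<in>UNIV. of_nat (n y) * bvec v y h)"
    then show ?thesis by (intro exI[of _ n]) (cases \<sigma>; simp add: sgnb_def)
  qed
qed

text \<open>Both \<open>\<phi> (E x)\<close> and \<open>\<phi> (F x)\<close> are multiples of the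
  corresponding generators at \<open>y\<close>, hence so is their bracket of
  \<open>[E y, F y]\<close>. Since \<open>I\<close> meets the Cartan part only in zero, the relation
  between coroots lifts from the quotient to \<open>hspace v\<close>.\<close>

theorem simple_coroot_proportional:
  assumes "bvec u x = bvec v y"
  shows "\<exists>c. avec u x = c *\<^sub>C avec v y"
proof -
  have gen: "\<exists>c. \<phi> (gen \<sigma> x) \<approx> Scale c (gen \<sigma> y)" for \<sigma>
  proof -
    obtain i t where t: "homogeneous v i t" "wt (\<lambda>h. sgnb \<sigma> * bvec u x h) t" "\<phi> (gen \<sigma> x) \<approx> t"
      by (rule iso_gen)
    obtain c where "t \<approx> Scale c (gen \<sigma> y)"
      using simple_root_vector[OF t(1)] t(2) assms by auto
    then show ?thesis using eqv_trans[OF t(3)] by blast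
  qed
  obtain c where c: "\<phi> (E x) \<approx> Scale c (E y)" using gen[of True] by (auto simp: gen_def)
  obtain d where d: "\<phi> (F x) \<approx> Scale d (F y)" using gen[of False] by (auto simp: gen_def)
  have a: "avec u x \<in> hspace v" "avec v y \<in> hspace v" and sub: "cvec.subspace (hspace v)"
    using src.avec_hspace avec_hspace root_datum hspace_eq by (auto simp: is_root_datum_def)
  have "Cartan (avec u x) \<approx> Bracket (\<phi> (E x)) (\<phi> (F x))"
    by (rule eqv_sym[OF iso_coroot])
  also have "\<dots> \<approx> Bracket (Scale c (E y)) (Scale d (F y))"
    by (rule eqv_bracket[OF c d])
  also have "\<dots> \<approx> Scale c (Bracket (E y) (Scale d (F y)))"
    by (rule bracket_scale_left)
  also have "\<dots> \<approx> Scale c (Scale d (Bracket (E y) (F y)))"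
    by (rule eqv_scale[OF bracket_scale_right])
  also have "\<dots> \<approx> Scale c (Scale d (Cartan (avec v y)))"
    by (rule eqv_scale[OF eqv_scale[OF eqv_hb[OF hb_E_F_same]]])
  finally have "Plus (Cartan (avec u x)) (Scale (- c * d) (Cartan (avec v y))) \<approx>
      Plus (Scale c (Scale d (Cartan (avec v y)))) (Scale (- c * d) (Cartan (avec v y)))"
    by (intro eqv_plus eqv_refl)
  also have "\<dots> \<approx> Zero" by (rule eqv_linear) simp
  finally have zero: "Plus (Cartan (avec u x)) (Scale (- c * d) (Cartan (avec v y))) \<approx> Zero" .
  have ay: "(- c * d) *\<^sub>C avec v y \<in> hspace v"
    by (rule cvec.subspace_scale[OF sub a(2)])
  have "Cartan (avec u x + (- c * d) *\<^sub>C avec v y) \<approx>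
      Plus (Cartan (avec u x)) (Cartan ((- c * d) *\<^sub>C avec v y))"
    by (rule eqv_hb[OF hb_cartan_plus[OF a(1) ay]])
  also have "\<dots> \<approx> Plus (Cartan (avec u x)) (Scale (- c * d) (Cartan (avec v y)))"
    by (rule eqv_plus[OF eqv_refl eqv_hb[OF hb_cartan_scale[OF a(2)]]])
  also note zero
  finally have "Cartan (avec u x + (- c * d) *\<^sub>C avec v y) \<in> I"
    by (simp only: eqv_zero_iff)
  then have "avec u x + (- c * d) *\<^sub>C avec v y = 0"
    by (rule cartan_injective[OF cvec.subspace_add[OF sub a(1) ay]])
  then have "avec u x = (c * d) *\<^sub>C avec v y"
    by (simp add: add_eq_0_iff cvec.scale_minus_left)
  then show ?thesis by blast
qed

end

section \<open>Reflexions\<close>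

lemma bvec_dual: "is_root_datum v \<Longrightarrow> bvec v y \<in> dual_space (hspace v)"
  and avec_in_hspace: "is_root_datum v \<Longrightarrow> avec v y \<in> hspace v"
  and subspace_hspace: "is_root_datum v \<Longrightarrow> cvec.subspace (hspace v)"
  by (simp_all add: is_root_datum_def)

lemma bvec_add: "is_root_datum v \<Longrightarrow> s \<in> hspace v \<Longrightarrow> t \<in> hspace v \<Longrightarrow> bvec v y (s + t) = bvec v y s + bvec v y t"
  and bvec_scale: "is_root_datum v \<Longrightarrow> s \<in> hspace v \<Longrightarrow> bvec v y (c *\<^sub>C s) = c * bvec v y s"
  and bvec_outside: "is_root_datum v \<Longrightarrow> s \<notin> hspace v \<Longrightarrow> bvec v y s = 0"
  using bvec_dual[of v y] by (simp_all add: dual_space_def)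

lemma scaleC_cancel:
  fixes a :: "'h::complex_vector"
  shows "a + (-2) *\<^sub>C a = - a" "a - 2 *\<^sub>C a = - a"
  using cvec.scale_left_distrib[of 1 "-2" a] by simp_all

lemma avec_independent_zero:
  fixes v :: "('h::complex_vector, 'x::finite) root_datum"
  assumes "is_root_datum v" and "(\<Sum>x\<in>UNIV. c x *\<^sub>C avec v x) = 0"
  shows "c y = 0"
  using assms unfolding is_root_datum_def by blast

lemma bvec_independent_zero:
  fixes v :: "('h::complex_vector, 'x::finite) root_datum"
  assumes "is_root_datum v" and "\<And>t. t \<in> hspace v \<Longrightarrow> (\<Sum>x\<in>UNIV. c x * bvec v x t) = 0"
  shows "c y = 0"
  using assms unfolding is_root_datum_def by blast

text \<open>
  The value \<open>-2\<close> of both coefficients at \<open>x\<close> makes the formulas for \<open>y \<noteq> x\<close> give the sign change at \<open>x\<close> too.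
\<close>

lemma reflexion_shape:
  obtains k m where "k x = -2" "m x = -2"
    "\<And>y. avec (reflexion x v) y = avec v y + k y *\<^sub>C avec v x"
    "\<And>y. bvec (reflexion x v) y = (\<lambda>t. bvec v y t + m y * bvec v x t)"
proof (cases "cartan v x x = 0")
  case False
  then show ?thesis
    by (intro that[of "\<lambda>y. - (2 * cartan v y x / cartan v x x)" "\<lambda>y. - (2 * cartan v x y / cartan v x x)"])
      (simp_all add: reflexion_def reflexion_aniso_def cvec.scale_minus_left)
next
  case True
  define k m where "k = (\<lambda>y. if y = x then -2 else if cartan v x y = 0 then 0 else cartan v y x / cartan v x y)"
    and "m = (\<lambda>y. if y = x then -2 else if cartan v x y = 0 then 0 else 1 :: complex)"
  have "avec (reflexion x v) y = avec v y + k y *\<^sub>C avec v x" for y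
    using True scaleC_cancel[of "avec v x"] by (simp add: reflexion_def reflexion_iso_def k_def)
  moreover have "bvec (reflexion x v) y = (\<lambda>t. bvec v y t + m y * bvec v x t)" for y
    using True by (auto simp: reflexion_def reflexion_iso_def m_def)
  ultimately show ?thesis
    by (intro that[of k m]) (simp_all add: k_def m_def)
qed

lemma hspace_reflexion [simp]: "hspace (reflexion x v) = hspace v"
  by (simp add: reflexion_def reflexion_aniso_def reflexion_iso_def)

text \<open>The hypothesis lists the coefficients, over the old family, of a combination of the
  reflected one. Off \<open>x\<close> they are \<open>c y\<close>; once those vanish, the one at
  \<open>x\<close> is \<open>c x - 2 * c x = - c x\<close>.\<close>

lemma transvection_coefficients_zero:
  fixes c k :: "'x::finite \<Rightarrow> complex"
  assumes "\<And>y. c y + of_bool (y = x) * (\<Sum>z\<in>UNIV. c z * k z) = 0" and "k x = -2"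
  shows "c y = 0"
proof -
  have off: "c z = 0" if "z \<noteq> x" for z
    using assms(1)[of z] that by simp
  have "(\<Sum>z\<in>UNIV. c z * k z) = c x * k x"
    by (subst sum.remove[of _ x]) (auto intro!: sum.neutral simp: off)
  then have "c x = 0"
    using assms(1)[of x] assms(2) by simp
  with off show ?thesis by (cases "y = x") auto
qed

lemma is_root_datum_reflexion:
  fixes v :: "('h::complex_vector, 'x::finite) root_datum"
  assumes "is_root_datum v"
  shows "is_root_datum (reflexion x v)"
proof -
  obtain k m where km: "k x = -2" "m x = -2"
    "\<And>y. avec (reflexion x v) y = avec v y + k y *\<^sub>C avec v x"
    "\<And>y. bvec (reflexion x v) y = (\<lambda>t. bvec v y t + m y * bvec v x t)"
    by (rule reflexion_shape) blast
  have avec: "avec (reflexion x v) y \<in> hspace v" for y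
    using assms unfolding km
    by (intro cvec.subspace_add cvec.subspace_scale) (auto simp: is_root_datum_def)
  have bvec: "bvec (reflexion x v) y \<in> dual_space (hspace v)" for y
    using assms unfolding km
    by (simp add: dual_space_def bvec_add bvec_scale bvec_outside algebra_simps)
  have a_ind: "c y = 0" if "(\<Sum>y\<in>UNIV. c y *\<^sub>C avec (reflexion x v) y) = 0" for c y
  proof -
    have "(\<Sum>y\<in>UNIV. c y *\<^sub>C avec (reflexion x v) y) =
        (\<Sum>y\<in>UNIV. c y *\<^sub>C avec v y) + (\<Sum>y\<in>UNIV. c y * k y) *\<^sub>C avec v x"
      by (simp add: km cvec.scale_right_distrib sum.distrib cvec.scale_sum_left)
    also have "(\<Sum>y\<in>UNIV. c y * k y) *\<^sub>C avec v x =
        (\<Sum>y\<in>UNIV. (of_bool (y = x) * (\<Sum>z\<in>UNIV. c z * k z)) *\<^sub>C avec v y)"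
      by (subst sum.remove[of _ x]) (auto intro!: sum.neutral)
    finally have "(\<Sum>y\<in>UNIV. (c y + of_bool (y = x) * (\<Sum>z\<in>UNIV. c z * k z)) *\<^sub>C avec v y) = 0"
      using that by (simp add: cvec.scale_left_distrib sum.distrib)
    then have "c y + of_bool (y = x) * (\<Sum>z\<in>UNIV. c z * k z) = 0" for y
      by (rule avec_independent_zero[OF assms])
    from transvection_coefficients_zero[where c = c and k = k and x = x, OF this km(1)] show ?thesis .
  qed
  have b_ind: "c y = 0" if "\<forall>t\<in>hspace v. (\<Sum>y\<in>UNIV. c y * bvec (reflexion x v) y t) = 0" for c y
  proof -
    have "(\<Sum>y\<in>UNIV. (c y + of_bool (y = x) * (\<Sum>z\<in>UNIV. c z * m z)) * bvec v y t) = 0"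
      if t: "t \<in> hspace v" for t
    proof -
      have "(\<Sum>y\<in>UNIV. c y * bvec (reflexion x v) y t) =
          (\<Sum>y\<in>UNIV. c y * bvec v y t) + (\<Sum>y\<in>UNIV. c y * m y) * bvec v x t"
        by (simp add: km algebra_simps sum.distrib sum_distrib_left)
      also have "(\<Sum>y\<in>UNIV. c y * m y) * bvec v x t =
          (\<Sum>y\<in>UNIV. (of_bool (y = x) * (\<Sum>z\<in>UNIV. c z * m z)) * bvec v y t)"
        by (subst sum.remove[of _ x]) (auto intro!: sum.neutral)
      finally show ?thesis
        using \<open>\<forall>t\<in>hspace v. _ t = 0\<close> t by (simp add: distrib_right sum.distrib)
    qed
    then have "c y + of_bool (y = x) * (\<Sum>z\<in>UNIV. c z * m z) = 0" for y
      by (rule bvec_independent_zero[OF assms])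
    from transvection_coefficients_zero[where c = c and k = m and x = x, OF this km(2)] show ?thesis .
  qed
  show ?thesis
    unfolding is_root_datum_def hspace_reflexion
    using assms avec bvec a_ind b_ind by (auto simp: is_root_datum_def)
qed

lemma cartan_reflexion:
  assumes "is_root_datum v"
    and "avec u y = avec v y + k *\<^sub>C avec v x"
    and "bvec u z = (\<lambda>t. bvec v z t + m * bvec v x t)"
  shows "cartan u y z = cartan v y z + k * cartan v x z + m * (cartan v y x + k * cartan v x x)"
proof -
  have "bvec v w (avec v y + k *\<^sub>C avec v x) = bvec v w (avec v y) + k * bvec v w (avec v x)" for w
    using assms(1) by (simp add: bvec_add bvec_scale avec_in_hspace cvec.subspace_scale subspace_hspace)
  then show ?thesis
    unfolding cartan_def assms by simp
qed

lemma cartan_reflexion_aniso: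
  assumes "is_root_datum v" "cartan v x x \<noteq> 0"
  shows "cartan (reflexion_aniso x v) = cartan v"
proof (intro ext)
  fix y z
  have "cartan (reflexion_aniso x v) y z = cartan v y z + - (2 * cartan v y x / cartan v x x) * cartan v x z +
      - (2 * cartan v x z / cartan v x x) * (cartan v y x + - (2 * cartan v y x / cartan v x x) * cartan v x x)"
    by (rule cartan_reflexion[OF assms(1)]) (simp_all add: reflexion_aniso_def cvec.scale_minus_left)
  also have "\<dots> = cartan v y z"
    using assms(2) by (simp add: field_simps)
  finally show "cartan (reflexion_aniso x v) y z = cartan v y z" .
qed

text \<open>Only row and column \<open>x\<close> are computed: they determine a second reflexion at
  \<open>x\<close>, and the isotropic reflexion may change the other entries.\<close>

lemma cartan_reflexion_iso:
  assumes "is_root_datum v" "cartan v x x = 0"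
  shows "cartan (reflexion_iso x v) x y = - cartan v x y"
    and "cartan (reflexion_iso x v) y x = - cartan v y x"
proof -
  have *: "avec (reflexion_iso x v) x = avec v x + (-2) *\<^sub>C avec v x"
    "bvec (reflexion_iso x v) x = (\<lambda>t. bvec v x t + -2 * bvec v x t)"
    by (auto simp: reflexion_iso_def scaleC_cancel)
  obtain k m where km: "k x = -2" "m x = -2"
    "\<And>y. avec (reflexion x v) y = avec v y + k y *\<^sub>C avec v x"
    "\<And>y. bvec (reflexion x v) y = (\<lambda>t. bvec v y t + m y * bvec v x t)"
    by (rule reflexion_shape) blast
  have r: "reflexion x v = reflexion_iso x v"
    using assms(2) by (simp add: reflexion_def)
  show "cartan (reflexion_iso x v) x y = - cartan v x y"
    using cartan_reflexion[OF assms(1) *(1) km(4)[of y, unfolded r]] assms(2) by simp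
  show "cartan (reflexion_iso x v) y x = - cartan v y x"
    using cartan_reflexion[OF assms(1) km(3)[of y, unfolded r] *(2)] assms(2) by simp
qed

lemma bit_add_self_left: "(1::bit) + (1 + p) = p"
  by (cases p) simp_all

text \<open>The vectors \<open>a(x)\<close> and \<open>b(x)\<close> change sign, while the
  coefficients multiplying them do not: row and column \<open>x\<close> are either kept
  (anisotropic) or both negated (isotropic), so the ratios agree.\<close>

lemma reflexion_reflexion:
  fixes v :: "('h::complex_vector, 'x::finite) root_datum"
  assumes "is_root_datum v"
  shows "reflexion x (reflexion x v) = v"
proof (cases "cartan v x x = 0")
  case False
  note c = cartan_reflexion_aniso[OF assms False]
  have "reflexion x (reflexion x v) = reflexion_aniso x (reflexion_aniso x v)"
    using False by (simp add: reflexion_def c)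
  also have "\<dots> = v"
  proof (rule root_datum.equality)
    have "avec (reflexion_aniso x (reflexion_aniso x v)) y = avec v y" for y
    proof -
      have "avec (reflexion_aniso x v) x = - avec v x"
        using False scaleC_cancel[of "avec v x"] by (simp add: reflexion_aniso_def cvec.scale_minus_left)
      then have "avec (reflexion_aniso x (reflexion_aniso x v)) y =
          avec (reflexion_aniso x v) y - (2 * cartan v y x / cartan v x x) *\<^sub>C - avec v x"
        using c by (simp add: reflexion_aniso_def[of x "reflexion_aniso x v"])
      then show ?thesis
        by (simp add: reflexion_aniso_def cvec.scale_minus_right)
    qed
    then show "avec (reflexion_aniso x (reflexion_aniso x v)) = avec v" by blast
    have "bvec (reflexion_aniso x (reflexion_aniso x v)) y t = bvec v y t" for y t
    proof -
      have "bvec (reflexion_aniso x v) x = (\<lambda>t. - bvec v x t)"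
        using False by (auto simp: reflexion_aniso_def)
      then have "bvec (reflexion_aniso x (reflexion_aniso x v)) y t =
          bvec (reflexion_aniso x v) y t - 2 * cartan v x y / cartan v x x * - bvec v x t"
        using c by (simp add: reflexion_aniso_def[of x "reflexion_aniso x v"])
      then show ?thesis
        by (simp add: reflexion_aniso_def)
    qed
    then show "bvec (reflexion_aniso x (reflexion_aniso x v)) = bvec v" by blast
  qed (simp_all add: reflexion_aniso_def)
  finally show ?thesis .
next
  case True
  note c = cartan_reflexion_iso[OF assms True]
  have "reflexion x (reflexion x v) = reflexion_iso x (reflexion_iso x v)"
    using True by (simp add: reflexion_def c)
  also have "\<dots> = v"
  proof (rule root_datum.equality)
    show "avec (reflexion_iso x (reflexion_iso x v)) = avec v"
      unfolding reflexion_iso_def[of x "reflexion_iso x v"]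
      by (auto simp: fun_eq_iff c) (auto simp: reflexion_iso_def cvec.scale_minus_right)
    show "bvec (reflexion_iso x (reflexion_iso x v)) = bvec v"
      unfolding reflexion_iso_def[of x "reflexion_iso x v"]
      by (auto simp: fun_eq_iff c) (auto simp: reflexion_iso_def)
    show "par (reflexion_iso x (reflexion_iso x v)) = par v"
      unfolding reflexion_iso_def[of x "reflexion_iso x v"]
      by (auto simp: fun_eq_iff c) (auto simp: reflexion_iso_def bit_add_self_left)
  qed (simp_all add: reflexion_iso_def)
  finally show ?thesis .
qed

lemma reflectable_reflexion:
  assumes "is_root_datum v" "reflectable v x"
  shows "reflectable (reflexion x v) x"
proof (cases "cartan v x x = 0")
  case False
  then show ?thesis
    using assms cartan_reflexion_aniso[OF assms(1) False]
    by (simp add: reflectable_def reflexion_def) (simp add: reflexion_aniso_def)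
next
  case True
  then show ?thesis
    using assms cartan_reflexion_iso[OF assms(1) True]
    by (simp add: reflectable_def reflexion_def) (simp add: reflexion_iso_def)
qed

lemma cartan_reflexion_diag:
  assumes "is_root_datum v"
  shows "cartan (reflexion x v) x x = 0 \<longleftrightarrow> cartan v x x = 0"
  using cartan_reflexion_aniso[OF assms] cartan_reflexion_iso[OF assms]
  by (cases "cartan v x x = 0") (simp_all add: reflexion_def)

section \<open>The skeleton as a symmetric and transitive relation\<close>

lemma Sk_root_datum:
  "u \<in> Sk v \<Longrightarrow> is_root_datum v \<Longrightarrow> is_root_datum u"
  by (induction rule: Sk.induct) (auto intro: is_root_datum_reflexion)

lemma hspace_Sk: "u \<in> Sk v \<Longrightarrow> hspace u = hspace v"
  by (induction rule: Sk.induct) auto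

lemma Sk_trans: "w \<in> Sk u \<Longrightarrow> u \<in> Sk v \<Longrightarrow> w \<in> Sk v"
  by (induction rule: Sk.induct) (auto intro: Sk.intros)

lemma Sk_sym: "u \<in> Sk v \<Longrightarrow> is_root_datum v \<Longrightarrow> v \<in> Sk u"
proof (induction rule: Sk.induct)
  case Sk_refl
  show ?case by (rule Sk.Sk_refl)
next
  case (Sk_step u x)
  have rd: "is_root_datum u"
    using Sk_step.hyps(1) Sk_step.prems by (rule Sk_root_datum)
  have "reflexion x (reflexion x u) \<in> Sk (reflexion x u)"
    by (intro Sk.intros reflectable_reflexion rd Sk_step.hyps)
  then have "u \<in> Sk (reflexion x u)"
    by (simp add: reflexion_reflexion[OF rd])
  with Sk_step.IH[OF Sk_step.prems] show ?case by (rule Sk_trans)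
qed

lemma Sp_subset_Sk: "u \<in> Sp v \<Longrightarrow> u \<in> Sk v"
  by (induction rule: Sp.induct) (auto intro: Sk.intros)

lemma arrow_Sk: "u \<in> Sk v \<Longrightarrow> is_root_datum v \<Longrightarrow> arrow v id u"
proof (induction rule: Sk.induct)
  case Sk_refl
  then show ?case by (rule arrow_id)
next
  case (Sk_step u x)
  then have "arrow u id (reflexion x u)"
    by (intro arrow_reflexion Sk_root_datum[of u v])
  from arrow_comp[OF Sk_step.IH[OF Sk_step.prems] this] show ?case by simp
qed

section \<open>The Weyl group action on the skeleton\<close>

text \<open>Linearity is required on \<open>S\<close> only. Bijectivity on the ambient space
  together with being the identity off \<open>S\<close> makes the global \<open>inv w\<close>, used
  by \<open>weyl_act\<close>, invert the restriction to \<open>S\<close>.\<close>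

definition auto_on :: "'h::complex_vector set \<Rightarrow> ('h \<Rightarrow> 'h) \<Rightarrow> bool" where
  "auto_on S w \<longleftrightarrow> bij w \<and> (\<forall>s\<in>S. w s \<in> S) \<and> (\<forall>s. s \<notin> S \<longrightarrow> w s = s) \<and>
     (\<forall>s\<in>S. \<forall>t\<in>S. w (s + t) = w s + w t) \<and> (\<forall>c. \<forall>s\<in>S. w (c *\<^sub>C s) = c *\<^sub>C w s)"

lemma auto_on_id: "auto_on S id"
  by (simp add: auto_on_def)

lemma auto_on_comp: "auto_on S w \<Longrightarrow> auto_on S w' \<Longrightarrow> auto_on S (w \<circ> w')"
  by (auto simp: auto_on_def intro: bij_comp)

lemma auto_on_inv:
  assumes "auto_on S w" "cvec.subspace S"
  shows "auto_on S (inv w)"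
proof -
  have bij: "bij w" and inv: "w (inv w s) = s" "inv w (w s) = s" for s
    using assms(1) by (auto simp: auto_on_def bij_is_inj bij_is_surj surj_f_inv_f)
  have S: "inv w s \<in> S" if "s \<in> S" for s
    using assms(1) inv that unfolding auto_on_def by metis
  have out: "inv w s = s" if "s \<notin> S" for s
    using assms(1) inv that unfolding auto_on_def by metis
  have "inv w (s + t) = inv w s + inv w t" if "s \<in> S" "t \<in> S" for s t
  proof -
    have "w (inv w s + inv w t) = s + t"
      using assms(1) S that inv unfolding auto_on_def by simp
    then show ?thesis using inv(2) by metis
  qed
  moreover have "inv w (c *\<^sub>C s) = c *\<^sub>C inv w s" if "s \<in> S" for c s
  proof -
    have "w (c *\<^sub>C inv w s) = c *\<^sub>C s"
      using assms(1) S that inv unfolding auto_on_def by simp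
    then show ?thesis using inv(2) by metis
  qed
  ultimately show ?thesis
    using S out bij bij_imp_bij_inv unfolding auto_on_def by blast
qed

lemma auto_on_simps:
  assumes "auto_on S w"
  shows "w (inv w s) = s" "inv w (w s) = s" "inv w \<circ> w = id" "w \<circ> inv w = id" "inv (inv w) = w"
  using assms by (auto simp: auto_on_def bij_is_inj bij_is_surj surj_f_inv_f inv_inv_eq fun_eq_iff)

lemma weyl_act_id: "weyl_act id u = u"
  by (simp add: weyl_act_def)

lemma weyl_act_comp:
  assumes "auto_on S w" "auto_on S w'"
  shows "weyl_act (w \<circ> w') u = weyl_act w (weyl_act w' u)"
proof -
  have "inv (w \<circ> w') = inv w' \<circ> inv w"
    using assms by (auto simp: auto_on_def o_inv_distrib)
  then show ?thesis
    by (simp add: weyl_act_def comp_assoc)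
qed

lemma weyl_act_inv:
  assumes "auto_on S w"
  shows "weyl_act (inv w) (weyl_act w u) = u"
  by (simp add: weyl_act_def auto_on_simps[OF assms] comp_assoc)

lemma cartan_weyl_act:
  assumes "auto_on S w"
  shows "cartan (weyl_act w u) = cartan u"
  by (simp add: fun_eq_iff cartan_def weyl_act_def auto_on_simps[OF assms])

lemma reflectable_weyl_act:
  assumes "auto_on S w"
  shows "reflectable (weyl_act w u) = reflectable u"
  unfolding reflectable_def cartan_weyl_act[OF assms] by (simp add: weyl_act_def fun_eq_iff)

text \<open>All coefficients in a reflexion are made of Cartan entries, and these are unchanged by
  \<open>w\<close>.\<close>

lemma reflexion_weyl_act:
  assumes w: "auto_on (hspace u) w" and u: "is_root_datum u"
  shows "reflexion x (weyl_act w u) = weyl_act w (reflexion x u)"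
proof -
  have lin: "w (avec u y + c *\<^sub>C avec u x) = w (avec u y) + c *\<^sub>C w (avec u x)"
       "w (c *\<^sub>C avec u x) = c *\<^sub>C w (avec u x)" for y c
    using w u by (simp_all add: auto_on_def avec_in_hspace cvec.subspace_scale subspace_hspace)
  have neg: "w (- avec u x) = - w (avec u x)"
    using lin(2)[of "-1"] by simp
  have minus: "w (avec u y - c *\<^sub>C avec u x) = w (avec u y) - c *\<^sub>C w (avec u x)" for y c
    using lin(1)[of y "- c"] by (simp add: cvec.scale_minus_left)
  have "reflexion_aniso x (weyl_act w u) = weyl_act w (reflexion_aniso x u)"
    unfolding reflexion_aniso_def cartan_weyl_act[OF w]
    by (simp add: weyl_act_def minus fun_eq_iff)
  moreover have "reflexion_iso x (weyl_act w u) = weyl_act w (reflexion_iso x u)"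
    unfolding reflexion_iso_def cartan_weyl_act[OF w]
    by (auto simp: weyl_act_def lin neg fun_eq_iff)
  ultimately show ?thesis
    by (simp add: reflexion_def cartan_weyl_act[OF w])
qed

section \<open>Real roots of the skeleton\<close>

text \<open>The two consequences of admissibility, stated as equalities of functions; this is
  possible because all \<open>bvec\<close> vanish off the common space.\<close>

locale root_skeleton =
  fixes v :: "('h::complex_vector, 'x::finite) root_datum"
  assumes root_datum: "is_root_datum v"
    and coordinates: "\<And>u u' x. u \<in> Sk v \<Longrightarrow> u' \<in> Sk v \<Longrightarrow>
      \<exists>n. bvec u' x = (\<lambda>t. \<Sum>y\<in>UNIV. of_nat (n y) * bvec u y t) \<or>
          bvec u' x = (\<lambda>t. - (\<Sum>y\<in>UNIV. of_nat (n y) * bvec u y t))"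
    and proportional: "\<And>u u' x y. u \<in> Sk v \<Longrightarrow> u' \<in> Sk v \<Longrightarrow> bvec u' x = bvec u y \<Longrightarrow>
      \<exists>c. avec u' x = c *\<^sub>C avec u y"
begin

abbreviation "S \<equiv> hspace v"
abbreviation "D \<equiv> anisotropic_roots v"
abbreviation "pos \<equiv> positive_anisotropic_roots v"
abbreviation "rho \<equiv> root_reflection v"
abbreviation "P \<equiv> principal_roots v"
abbreviation neg :: "('h \<Rightarrow> complex) \<Rightarrow> 'h \<Rightarrow> complex" where "neg \<alpha> \<equiv> \<lambda>t. - \<alpha> t"

lemma Sk_rd: "u \<in> Sk v \<Longrightarrow> is_root_datum u"
  by (rule Sk_root_datum[OF _ root_datum])

lemma independent:
  assumes "u \<in> Sk v" "(\<lambda>t. \<Sum>y\<in>UNIV. c y * bvec u y t) = (\<lambda>t. \<Sum>y\<in>UNIV. d y * bvec u y t)"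
  shows "c = d"
  by (rule bvec_independent[OF Sk_rd[OF assms(1)]]) (use fun_cong[OF assms(2)] in simp)

lemma single: "(\<Sum>z\<in>UNIV. (r * of_bool (z = x)) * bvec u z t) = r * bvec u (x :: 'x) t"
  by (subst sum.remove[of _ x]) (auto intro!: sum.neutral)

lemma D_cases:
  assumes "\<alpha> \<in> D"
  obtains u x where "u \<in> Sk v" "reflectable u x" "cartan u x x \<noteq> 0" "\<alpha> = bvec u x"
  using assms unfolding anisotropic_roots_def by blast

lemma D_memI: "u \<in> Sk v \<Longrightarrow> reflectable u x \<Longrightarrow> cartan u x x \<noteq> 0 \<Longrightarrow> bvec u x \<in> D"
  unfolding anisotropic_roots_def by blast

text \<open>The factor \<open>c\<close> between the coroot vectors multiplies the diagonal Cartan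
  entry as well, and cancels in \<open>2 / a_xx\<close>. Whether a root is anisotropic thus does not
  depend on the vertex.\<close>

lemma cartan_proportional:
  assumes "u \<in> Sk v" "u' \<in> Sk v" "bvec u' x' = bvec u x" "cartan u' x' x' \<noteq> 0"
  shows "(2 / cartan u' x' x') *\<^sub>C avec u' x' = (2 / cartan u x x) *\<^sub>C avec u x"
    and "cartan u x x \<noteq> 0"
proof -
  obtain c where c: "avec u' x' = c *\<^sub>C avec u x"
    using proportional[OF assms(1-3)] by blast
  have *: "cartan u' x' x' = c * cartan u x x"
    using c assms(3) bvec_scale[OF Sk_rd avec_in_hspace[OF Sk_rd], OF assms(1,1)]
    by (simp add: cartan_def)
  with assms(4) show nz: "cartan u x x \<noteq> 0" by auto
  from * assms(4) have "c \<noteq> 0" by auto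
  with nz show "(2 / cartan u' x' x') *\<^sub>C avec u' x' = (2 / cartan u x x) *\<^sub>C avec u x"
    by (simp add: * c)
qed

text \<open>Makes the definite description in \<open>coroot\<close> meaningful. The formula is
  available at every vertex where the root is simple, reflectable there or not.\<close>

lemma coroot_eq:
  assumes "u \<in> Sk v" "bvec u x \<in> D"
  shows "coroot v (bvec u x) = (2 / cartan u x x) *\<^sub>C avec u x" "cartan u x x \<noteq> 0"
proof -
  obtain u' x' where u': "u' \<in> Sk v" "reflectable u' x'" "cartan u' x' x' \<noteq> 0" "bvec u' x' = bvec u x"
    using assms(2) by (metis D_cases)
  note eq = cartan_proportional[OF assms(1) u'(1,4,3)]
  show "cartan u x x \<noteq> 0" by (rule eq)
  show "coroot v (bvec u x) = (2 / cartan u x x) *\<^sub>C avec u x"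
    unfolding coroot_def
  proof (rule the_equality)
    show "\<exists>w\<in>Sk v. \<exists>z. reflectable w z \<and> cartan w z z \<noteq> 0 \<and> bvec w z = bvec u x \<and>
        (2 / cartan u x x) *\<^sub>C avec u x = (2 / cartan w z z) *\<^sub>C avec w z"
      using u' eq(1) by metis
  next
    fix c
    assume "\<exists>w\<in>Sk v. \<exists>z. reflectable w z \<and> cartan w z z \<noteq> 0 \<and> bvec w z = bvec u x \<and>
        c = (2 / cartan w z z) *\<^sub>C avec w z"
    then show "c = (2 / cartan u x x) *\<^sub>C avec u x"
      using cartan_proportional(1)[OF assms(1)] by metis
  qed
qed

lemma root_facts:
  assumes "\<alpha> \<in> D"
  shows "coroot v \<alpha> \<in> S" "\<alpha> (coroot v \<alpha>) = 2" "\<alpha> \<in> dual_space S"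
proof -
  obtain u x where u: "u \<in> Sk v" "cartan u x x \<noteq> 0" "\<alpha> = bvec u x"
    using assms by (rule D_cases)
  note c = coroot_eq(1)[OF u(1) assms[unfolded u(3)]]
  note rd = Sk_rd[OF u(1)]
  have h: "hspace u = S" by (rule hspace_Sk[OF u(1)])
  show "coroot v \<alpha> \<in> S"
    using cvec.subspace_scale[OF subspace_hspace[OF rd] avec_in_hspace[OF rd]] h by (simp add: u(3) c)
  show "\<alpha> (coroot v \<alpha>) = 2"
    unfolding u(3) c using u(2) by (simp add: bvec_scale[OF rd avec_in_hspace[OF rd]] cartan_def)
  show "\<alpha> \<in> dual_space S"
    using bvec_dual[OF rd] h by (simp add: u(3))
qed

lemma root_linear:
  assumes "\<alpha> \<in> D"
  shows "s \<in> S \<Longrightarrow> t \<in> S \<Longrightarrow> \<alpha> (s + t) = \<alpha> s + \<alpha> t" "s \<in> S \<Longrightarrow> \<alpha> (c *\<^sub>C s) = c * \<alpha> s"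
    "s \<in> S \<Longrightarrow> t \<in> S \<Longrightarrow> \<alpha> (s - c *\<^sub>C t) = \<alpha> s - c * \<alpha> t" "s \<notin> S \<Longrightarrow> \<alpha> s = 0"
proof -
  show add: "s \<in> S \<Longrightarrow> t \<in> S \<Longrightarrow> \<alpha> (s + t) = \<alpha> s + \<alpha> t" for s t
    using root_facts(3)[OF assms] by (simp add: dual_space_def)
  show scale: "s \<in> S \<Longrightarrow> \<alpha> (c *\<^sub>C s) = c * \<alpha> s" for c s
    using root_facts(3)[OF assms] by (simp add: dual_space_def)
  show "s \<notin> S \<Longrightarrow> \<alpha> s = 0"
    using root_facts(3)[OF assms] by (simp add: dual_space_def)
  show "\<alpha> (s - c *\<^sub>C t) = \<alpha> s - c * \<alpha> t" if "s \<in> S" "t \<in> S"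
  proof -
    have "- c *\<^sub>C t \<in> S"
      by (rule cvec.subspace_scale[OF subspace_hspace[OF root_datum] that(2)])
    with add[OF that(1), of "- c *\<^sub>C t"] scale[OF that(2), of "- c"] show ?thesis
      by simp
  qed
qed

section \<open>Reflections in anisotropic roots and their action on the skeleton\<close>

lemma refl_refl:
  assumes "\<alpha> \<in> D"
  shows "rho \<alpha> (rho \<alpha> t) = t"
proof (cases "t \<in> S")
  case True
  then show ?thesis
    using root_linear(3)[OF assms True root_facts(1)[OF assms]] root_facts(2)[OF assms]
    by (simp add: root_reflection_def)
next
  case False
  then show ?thesis
    by (simp add: root_reflection_def root_linear(4)[OF assms])
qed

lemma refl_involution: "\<alpha> \<in> D \<Longrightarrow> rho \<alpha> \<circ> rho \<alpha> = id"
  by (simp add: fun_eq_iff refl_refl)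

lemma inv_refl: "\<alpha> \<in> D \<Longrightarrow> inv (rho \<alpha>) = rho \<alpha>"
  by (simp add: inv_unique_comp refl_involution)

lemma auto_on_refl:
  assumes "\<alpha> \<in> D"
  shows "auto_on S (rho \<alpha>)"
proof -
  note sub = subspace_hspace[OF root_datum] and c = root_facts(1)[OF assms]
  have "bij (rho \<alpha>)"
    using refl_involution[OF assms] by (rule o_bij[rotated]) (rule refl_involution[OF assms])
  moreover have "rho \<alpha> s \<in> S" if "s \<in> S" for s
    unfolding root_reflection_def by (intro cvec.subspace_diff[OF sub] cvec.subspace_scale[OF sub] c that)
  moreover have "rho \<alpha> s = s" if "s \<notin> S" for s
    using that by (simp add: root_reflection_def root_linear(4)[OF assms])
  moreover have "rho \<alpha> (s + t) = rho \<alpha> s + rho \<alpha> t" if "s \<in> S" "t \<in> S" for s t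
    by (simp add: root_reflection_def root_linear(1)[OF assms that] cvec.scale_left_distrib)
  moreover have "rho \<alpha> (k *\<^sub>C s) = k *\<^sub>C rho \<alpha> s" if "s \<in> S" for k s
    by (simp add: root_reflection_def root_linear(2)[OF assms that] cvec.scale_right_diff_distrib)
  ultimately show ?thesis by (simp add: auto_on_def)
qed

lemma reflexion_eq_weyl_act:
  assumes "u \<in> Sk v" "reflectable u x" "cartan u x x \<noteq> 0"
  shows "reflexion x u = weyl_act (rho (bvec u x)) u"
proof -
  note D = D_memI[OF assms]
  note c = coroot_eq(1)[OF assms(1) D]
  note rd = Sk_rd[OF assms(1)] and h = hspace_Sk[OF assms(1)]
  have av: "rho (bvec u x) (avec u y) = avec u y - (2 * cartan u y x / cartan u x x) *\<^sub>C avec u x" for y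
    by (simp add: root_reflection_def c cartan_def)
  have bv: "bvec u y (rho (bvec u x) t) = bvec u y t - 2 * cartan u x y / cartan u x x * bvec u x t" for y t
  proof (cases "t \<in> S")
    case True
    have "bvec u y (t + (- bvec u x t * (2 / cartan u x x)) *\<^sub>C avec u x) =
        bvec u y t + (- bvec u x t * (2 / cartan u x x)) * bvec u y (avec u x)"
      using True h bvec_add[OF rd _ cvec.subspace_scale[OF subspace_hspace[OF rd] avec_in_hspace[OF rd]]]
      by (simp only: bvec_scale[OF rd avec_in_hspace[OF rd]])
    then show ?thesis
      by (simp add: root_reflection_def c cartan_def)
  next
    case False
    then have "bvec u z t = 0" for z using h bvec_outside[OF rd] by simp
    then show ?thesis by (simp add: root_reflection_def)
  qed
  show ?thesis
    using assms(3)
    by (simp add: reflexion_def reflexion_aniso_def weyl_act_def av inv_refl[OF D] fun_eq_iff bv)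
qed

text \<open>The action commutes with reflexions, so a path from \<open>u0\<close> to
  \<open>u\<close> is carried to a path from \<open>weyl_act w u0\<close>; one vertex decides for
  all.\<close>

lemma weyl_act_Sk:
  assumes "auto_on S w" "u0 \<in> Sk v" "weyl_act w u0 \<in> Sk v" "u \<in> Sk v"
  shows "weyl_act w u \<in> Sk v"
proof -
  have "u \<in> Sk u0"
    using assms(4) Sk_sym[OF assms(2) root_datum] by (rule Sk_trans)
  then show ?thesis
  proof (induction rule: Sk.induct)
    case Sk_refl
    show ?case by (rule assms(3))
  next
    case (Sk_step u x)
    have u: "u \<in> Sk v" using Sk_step.hyps(1) assms(2) by (rule Sk_trans)
    have "auto_on (hspace u) w" using assms(1) hspace_Sk[OF u] by simp
    from reflexion_weyl_act[OF this Sk_rd[OF u], of x] show ?case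
      using Sk.Sk_step[OF Sk_step.IH, of x] Sk_step.hyps(2)
      by (simp add: reflectable_weyl_act[OF assms(1)])
  qed
qed

text \<open>A group of automorphisms containing all reflections; stability of the skeleton is the
  property from which invariance of roots and coroots follows.\<close>

definition weyl_auto :: "('h \<Rightarrow> 'h) \<Rightarrow> bool" where
  "weyl_auto w \<longleftrightarrow> auto_on S w \<and> (\<forall>u\<in>Sk v. weyl_act w u \<in> Sk v)"

lemma weyl_autoD: "weyl_auto w \<Longrightarrow> auto_on S w" "weyl_auto w \<Longrightarrow> u \<in> Sk v \<Longrightarrow> weyl_act w u \<in> Sk v"
  by (auto simp: weyl_auto_def)

lemma weyl_auto_refl:
  assumes "\<alpha> \<in> D"
  shows "weyl_auto (rho \<alpha>)"
proof -
  obtain u x where u: "u \<in> Sk v" "reflectable u x" "cartan u x x \<noteq> 0" "\<alpha> = bvec u x"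
    using assms by (rule D_cases)
  then have "weyl_act (rho \<alpha>) u \<in> Sk v"
    using reflexion_eq_weyl_act[OF u(1-3)] Sk.Sk_step[OF u(1,2)] by simp
  then show ?thesis
    unfolding weyl_auto_def using auto_on_refl[OF assms] weyl_act_Sk u(1) by blast
qed

lemma weyl_auto_id: "weyl_auto id"
  by (simp add: weyl_auto_def auto_on_id weyl_act_id)

lemma weyl_auto_comp: "weyl_auto w \<Longrightarrow> weyl_auto w' \<Longrightarrow> weyl_auto (w \<circ> w')"
  unfolding weyl_auto_def by (auto simp: weyl_act_comp intro: auto_on_comp)

lemma weyl_auto_inv:
  assumes "weyl_auto w"
  shows "weyl_auto (inv w)"
proof -
  note w = weyl_autoD(1)[OF assms]
  have i: "auto_on S (inv w)" by (rule auto_on_inv[OF w subspace_hspace[OF root_datum]])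
  \<comment> \<open>The deciding vertex is \<open>weyl_act w v\<close>, which \<open>inv w\<close>
    carries back to \<open>v\<close>.\<close>
  have "weyl_act (inv w) (weyl_act w v) \<in> Sk v"
    by (simp add: weyl_act_inv[OF w] Sk.Sk_refl)
  then show ?thesis
    unfolding weyl_auto_def using i weyl_act_Sk weyl_autoD(2)[OF assms Sk.Sk_refl] by blast
qed

text \<open>Under the contragredient action \<open>\<alpha> \<circ> inv w\<close> is the root
  usually written \<open>w \<alpha>\<close>, and \<open>\<beta> \<circ> w\<close> is the image of
  \<open>\<beta>\<close> under the inverse of \<open>w\<close>.\<close>

lemma weyl_act_root:
  assumes "weyl_auto w" "\<alpha> \<in> D"
  shows "\<alpha> \<circ> inv w \<in> D" "coroot v (\<alpha> \<circ> inv w) = w (coroot v \<alpha>)"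
proof -
  note w = weyl_autoD(1)[OF assms(1)]
  obtain u x where u: "u \<in> Sk v" "reflectable u x" "cartan u x x \<noteq> 0" "\<alpha> = bvec u x"
    using assms(2) by (rule D_cases)
  have b: "bvec (weyl_act w u) x = \<alpha> \<circ> inv w" by (simp add: weyl_act_def u(4))
  note wu = weyl_autoD(2)[OF assms(1) u(1)]
  have "bvec (weyl_act w u) x \<in> D"
    by (rule D_memI[OF wu]) (use u in \<open>simp_all add: reflectable_weyl_act[OF w] cartan_weyl_act[OF w]\<close>)
  then show "\<alpha> \<circ> inv w \<in> D" by (simp only: b)
  have "coroot v (\<alpha> \<circ> inv w) = (2 / cartan u x x) *\<^sub>C avec (weyl_act w u) x"
    using coroot_eq(1)[OF wu \<open>bvec (weyl_act w u) x \<in> D\<close>]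
    by (simp only: b cartan_weyl_act[OF w])
  also have "\<dots> = w ((2 / cartan u x x) *\<^sub>C avec u x)"
    using w avec_in_hspace[OF Sk_rd[OF u(1)], of x] hspace_Sk[OF u(1)]
    by (simp add: auto_on_def weyl_act_def)
  also have "\<dots> = w (coroot v \<alpha>)"
    using coroot_eq(1)[OF u(1) assms(2)[unfolded u(4)]] by (simp add: u(4))
  finally show "coroot v (\<alpha> \<circ> inv w) = w (coroot v \<alpha>)" .
qed

lemma D_comp:
  assumes "weyl_auto w" "\<alpha> \<in> D"
  shows "\<alpha> \<circ> w \<in> D"
  using weyl_act_root(1)[OF weyl_auto_inv[OF assms(1)] assms(2)]
  by (simp add: auto_on_simps[OF weyl_autoD(1)[OF assms(1)]])

lemma refl_conjugate:
  assumes "weyl_auto w" "\<alpha> \<in> D"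
  shows "rho (\<alpha> \<circ> inv w) = w \<circ> rho \<alpha> \<circ> inv w"
proof
  fix t
  note w = weyl_autoD(1)[OF assms(1)]
  have w': "auto_on S (inv w)" by (rule weyl_autoD(1)[OF weyl_auto_inv[OF assms(1)]])
  show "rho (\<alpha> \<circ> inv w) t = (w \<circ> rho \<alpha> \<circ> inv w) t"
  proof (cases "t \<in> S")
    case True
    then have s: "inv w t \<in> S" using w' by (simp add: auto_on_def)
    have c: "- \<alpha> (inv w t) *\<^sub>C coroot v \<alpha> \<in> S"
      by (rule cvec.subspace_scale[OF subspace_hspace[OF root_datum] root_facts(1)[OF assms(2)]])
    have "w (inv w t + - \<alpha> (inv w t) *\<^sub>C coroot v \<alpha>) = w (inv w t) + w (- \<alpha> (inv w t) *\<^sub>C coroot v \<alpha>)"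
      using w s c unfolding auto_on_def by blast
    also have "w (- \<alpha> (inv w t) *\<^sub>C coroot v \<alpha>) = - \<alpha> (inv w t) *\<^sub>C w (coroot v \<alpha>)"
      using w root_facts(1)[OF assms(2)] unfolding auto_on_def by blast
    finally show ?thesis
      by (simp add: root_reflection_def weyl_act_root(2)[OF assms] auto_on_simps[OF w])
  next
    case False
    then have "inv w t = t" using w' by (simp add: auto_on_def)
    with False show ?thesis
      using w by (simp add: root_reflection_def root_linear(4)[OF assms(2)] auto_on_def)
  qed
qed

lemma root_comp_refl:
  assumes "\<alpha> \<in> D" "\<beta> \<in> D"
  shows "\<beta> \<circ> rho \<alpha> = (\<lambda>t. \<beta> t - \<beta> (coroot v \<alpha>) * \<alpha> t)"
proof
  fix t
  show "(\<beta> \<circ> rho \<alpha>) t = \<beta> t - \<beta> (coroot v \<alpha>) * \<alpha> t"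
  proof (cases "t \<in> S")
    case True
    then show ?thesis
      by (simp add: root_reflection_def root_linear(3)[OF assms(2) _ root_facts(1)[OF assms(1)]])
  next
    case False
    then show ?thesis
      by (simp add: root_reflection_def root_linear(4)[OF assms(2)] root_linear(4)[OF assms(1)])
  qed
qed

lemma root_comp_refl_self:
  assumes "\<alpha> \<in> D"
  shows "\<alpha> \<circ> rho \<alpha> = neg \<alpha>"
  using root_comp_refl[OF assms assms] root_facts(2)[OF assms] by auto

lemma comp_refl_refl: "\<alpha> \<in> D \<Longrightarrow> \<beta> \<circ> rho \<alpha> \<circ> rho \<alpha> = \<beta>"
  by (simp add: comp_assoc refl_involution)

lemma neg_D: "\<alpha> \<in> D \<Longrightarrow> neg \<alpha> \<in> D"
  using D_comp[OF weyl_auto_refl] root_comp_refl_self by metis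

section \<open>Signs of anisotropic roots at a vertex\<close>

lemma pos_iff: "\<beta> \<in> pos u \<longleftrightarrow> \<beta> \<in> D \<and> (\<exists>n. \<beta> = (\<lambda>t. \<Sum>y\<in>UNIV. of_nat (n y) * bvec u y t))"
  by (auto simp: positive_anisotropic_roots_def)

lemma pos_or_neg:
  assumes "u \<in> Sk v" "\<beta> \<in> D"
  shows "\<beta> \<in> pos u \<or> neg \<beta> \<in> pos u"
proof -
  obtain u' x where u': "u' \<in> Sk v" "\<beta> = bvec u' x"
    using assms(2) by (rule D_cases)
  obtain n where "\<beta> = (\<lambda>t. \<Sum>y\<in>UNIV. of_nat (n y) * bvec u y t) \<or>
          \<beta> = (\<lambda>t. - (\<Sum>y\<in>UNIV. of_nat (n y) * bvec u y t))"
    using coordinates[OF assms(1) u'(1), of x] unfolding u'(2)[symmetric] by blast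
  then show ?thesis
  proof
    assume "\<beta> = (\<lambda>t. \<Sum>y\<in>UNIV. of_nat (n y) * bvec u y t)"
    then show ?thesis using assms(2) by (auto simp: pos_iff)
  next
    assume "\<beta> = (\<lambda>t. - (\<Sum>y\<in>UNIV. of_nat (n y) * bvec u y t))"
    then have "neg \<beta> = (\<lambda>t. \<Sum>y\<in>UNIV. of_nat (n y) * bvec u y t)" by simp
    then show ?thesis using neg_D[OF assms(2)] unfolding pos_iff by blast
  qed
qed

text \<open>Otherwise \<open>\<beta>\<close> is \<open>n x\<close> times \<open>b_u(x)\<close>.
  Expanding \<open>b_u(x)\<close> at a vertex where \<open>\<beta>\<close> is simple makes
  \<open>n x\<close> a divisor of 1, so \<open>\<beta>\<close> would be
  \<open>b_u(x)\<close>.\<close>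

lemma root_support:
  assumes u: "u \<in> Sk v" and "\<beta> \<in> D" "\<beta> \<noteq> bvec u x"
    and n: "\<beta> = (\<lambda>t. \<Sum>y\<in>UNIV. of_nat (n y) * bvec u y t)"
  obtains y where "y \<noteq> x" "n y > 0"
proof (rule ccontr)
  assume "\<not> thesis"
  with that have z: "n y = 0" if "y \<noteq> x" for y using \<open>y \<noteq> x\<close> by blast
  have n1: "n = (\<lambda>y. n x * of_bool (y = x))"
    using z by auto
  have \<beta>: "\<beta> t = of_nat (n x) * bvec u x t" for t
    using single[of "of_nat (n x)" x u t] unfolding n by (subst n1) simp
  obtain u' z where u': "u' \<in> Sk v" "\<beta> = bvec u' z"
    using assms(2) by (rule D_cases)
  obtain m where "bvec u x = (\<lambda>t. \<Sum>y\<in>UNIV. of_nat (m y) * bvec u' y t) \<or>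
          bvec u x = (\<lambda>t. - (\<Sum>y\<in>UNIV. of_nat (m y) * bvec u' y t))"
    using coordinates[OF u'(1) u] by blast
  then obtain e :: int where e: "\<bar>e\<bar> = 1"
    "bvec u x = (\<lambda>t. of_int e * (\<Sum>y\<in>UNIV. of_nat (m y) * bvec u' y t))"
  proof
    assume "bvec u x = (\<lambda>t. \<Sum>y\<in>UNIV. of_nat (m y) * bvec u' y t)"
    then show ?thesis by (intro that[of 1]) auto
  next
    assume "bvec u x = (\<lambda>t. - (\<Sum>y\<in>UNIV. of_nat (m y) * bvec u' y t))"
    then show ?thesis by (intro that[of "-1"]) auto
  qed
  \<comment> \<open>The root \<open>\<beta> = b_u'(z)\<close> is compared with its expansion through
    \<open>b_u(x)\<close>; the coefficient at \<open>z\<close> gives a product of integers equal to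
    1.\<close>
  have "(\<lambda>t. \<Sum>y\<in>UNIV. (1 * of_bool (y = z)) * bvec u' y t) =
      (\<lambda>t. \<Sum>y\<in>UNIV. (of_nat (n x) * of_int e * of_nat (m y)) * bvec u' y t)"
    unfolding single using u'(2) \<beta> e(2) by (simp add: fun_eq_iff sum_distrib_left mult.assoc)
  from independent[OF u'(1) this] have "1 * of_bool (z = z) = of_nat (n x) * (of_int e :: complex) * of_nat (m z)"
    by (rule fun_cong)
  then have "of_int (int (n x) * (e * int (m z))) = (of_int 1 :: complex)"
    by (simp add: mult.assoc)
  then have "int (n x) * (e * int (m z)) = 1"
    by (simp only: of_int_eq_iff)
  then have "n x = 1"
    using pos_zmult_eq_1_iff_lemma[of "int (n x)"] by auto
  with \<beta> have "\<beta> = bvec u x" by auto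
  with assms(3) show False ..
qed

text \<open>Adding a multiple of \<open>b_u(x)\<close> cannot repair the negative coordinate that
  \<open>-\<beta>\<close> has away from \<open>x\<close>. This one fact serves isotropic reflexions,
  where the simple roots move, and principal reflections, where \<open>\<beta>\<close>
  moves.\<close>

lemma pos_not_neg_modulo:
  assumes "u \<in> Sk v" "\<beta> \<in> pos u" "\<beta> \<noteq> bvec u x"
  shows "(\<lambda>t. - \<beta> t + r * bvec u x t) \<noteq> (\<lambda>t. \<Sum>y\<in>UNIV. of_nat (m y) * bvec u y t)"
proof
  assume eq: "(\<lambda>t. - \<beta> t + r * bvec u x t) = (\<lambda>t. \<Sum>y\<in>UNIV. of_nat (m y) * bvec u y t)"
  obtain n where n: "\<beta> = (\<lambda>t. \<Sum>y\<in>UNIV. of_nat (n y) * bvec u y t)" and D: "\<beta> \<in> D"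
    using assms(2) by (auto simp: pos_iff)
  obtain y where y: "y \<noteq> x" "n y > 0"
    by (rule root_support[OF assms(1) D assms(3) n])
  have "(\<lambda>t. \<Sum>y\<in>UNIV. (r * of_bool (y = x)) * bvec u y t) =
      (\<lambda>t. \<Sum>y\<in>UNIV. (of_nat (n y) + of_nat (m y)) * bvec u y t)"
    unfolding single using fun_cong[OF eq]
    by (simp add: fun_eq_iff n sum.distrib algebra_simps)
  from fun_cong[OF independent[OF assms(1) this], of y] y have "of_nat (n y + m y) = (0 :: complex)"
    by simp
  then show False using y by (simp only: of_nat_eq_0_iff)
qed

text \<open>Otherwise all coordinates of \<open>\<beta>\<close> vanish, against
  \<open>\<beta> (coroot v \<beta>) = 2\<close>.\<close>

lemma pos_not_neg:
  assumes "u \<in> Sk v" "\<beta> \<in> pos u"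
  shows "neg \<beta> \<notin> pos u"
proof
  assume "neg \<beta> \<in> pos u"
  then obtain m where m: "neg \<beta> = (\<lambda>t. \<Sum>y\<in>UNIV. of_nat (m y) * bvec u y t)"
    by (auto simp: pos_iff)
  obtain n where n: "\<beta> = (\<lambda>t. \<Sum>y\<in>UNIV. of_nat (n y) * bvec u y t)" and D: "\<beta> \<in> D"
    using assms(2) by (auto simp: pos_iff)
  have "(\<Sum>y\<in>UNIV. (- of_nat (m y)) * bvec u y t) = \<beta> t" for t
    using fun_cong[OF m, of t, symmetric] by (simp add: sum_negf)
  then have "(\<lambda>t. \<Sum>y\<in>UNIV. of_nat (n y) * bvec u y t) = (\<lambda>t. \<Sum>y\<in>UNIV. (- of_nat (m y)) * bvec u y t)"
    using n by simp
  from independent[OF assms(1) this] have "of_nat (n y) = (- of_nat (m y) :: complex)" for y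
    by (rule fun_cong)
  then have "of_nat (n y + m y) = (0 :: complex)" for y
    by simp
  then have "n y + m y = 0" for y by (simp only: of_nat_eq_0_iff)
  then have "n y = 0" for y by (simp only: add_is_0)
  then have "\<beta> (coroot v \<beta>) = 0" by (simp add: n)
  then show False by (simp add: root_facts(2)[OF D])
qed

lemma pos_weyl_act:
  assumes "weyl_auto w"
  shows "\<beta> \<in> pos (weyl_act w u) \<longleftrightarrow> \<beta> \<circ> w \<in> pos u"
proof -
  note w = auto_on_simps[OF weyl_autoD(1)[OF assms]]
  have "\<beta> \<in> D \<longleftrightarrow> \<beta> \<circ> w \<in> D"
    using D_comp[OF assms, of \<beta>] weyl_act_root(1)[OF assms, of "\<beta> \<circ> w"] by (auto simp: comp_assoc w)
  moreover have "\<beta> = (\<lambda>t. \<Sum>y\<in>UNIV. of_nat (n y) * bvec (weyl_act w u) y t) \<longleftrightarrow>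
      \<beta> \<circ> w = (\<lambda>t. \<Sum>y\<in>UNIV. of_nat (n y) * bvec u y t)" for n
  proof -
    have eq: "(\<lambda>t. \<Sum>y\<in>UNIV. of_nat (n y) * bvec (weyl_act w u) y t) =
        (\<lambda>t. \<Sum>y\<in>UNIV. of_nat (n y) * bvec u y t) \<circ> inv w"
      by (simp add: weyl_act_def fun_eq_iff)
    show ?thesis
      unfolding eq
    proof
      assume *: "\<beta> = (\<lambda>t. \<Sum>y\<in>UNIV. of_nat (n y) * bvec u y t) \<circ> inv w"
      show "\<beta> \<circ> w = (\<lambda>t. \<Sum>y\<in>UNIV. of_nat (n y) * bvec u y t)"
        unfolding * by (simp add: comp_assoc w)
    next
      assume *: "\<beta> \<circ> w = (\<lambda>t. \<Sum>y\<in>UNIV. of_nat (n y) * bvec u y t)"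
      show "\<beta> = (\<lambda>t. \<Sum>y\<in>UNIV. of_nat (n y) * bvec u y t) \<circ> inv w"
        unfolding *[symmetric] by (simp add: comp_assoc w)
    qed
  qed
  ultimately show ?thesis by (simp add: pos_iff)
qed

lemma pos_isotropic_subset:
  assumes "u \<in> Sk v" "reflectable u x" "cartan u x x = 0"
  shows "pos u \<subseteq> pos (reflexion x u)"
proof
  fix \<beta> assume \<beta>: "\<beta> \<in> pos u"
  then have D: "\<beta> \<in> D" by (simp add: pos_iff)
  \<comment> \<open>Anisotropic roots are simple only at anisotropic places, and \<open>x\<close> is
    isotropic at \<open>u\<close>.\<close>
  have ne: "\<beta> \<noteq> bvec u x"
    using D coroot_eq(2)[OF assms(1), of x] assms(3) by auto
  note u' = Sk.Sk_step[OF assms(1,2)]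
  show "\<beta> \<in> pos (reflexion x u)"
  proof (rule ccontr)
    assume "\<beta> \<notin> pos (reflexion x u)"
    then have "neg \<beta> \<in> pos (reflexion x u)"
      using pos_or_neg[OF u' D] by blast
    then obtain m where m: "neg \<beta> = (\<lambda>t. \<Sum>y\<in>UNIV. of_nat (m y) * bvec (reflexion x u) y t)"
      by (auto simp: pos_iff)
    obtain k where k: "\<And>y. bvec (reflexion x u) y = (\<lambda>t. bvec u y t + k y * bvec u x t)"
      by (rule reflexion_shape) blast
    have "(\<lambda>t. - \<beta> t + (- (\<Sum>y\<in>UNIV. of_nat (m y) * k y)) * bvec u x t) =
        (\<lambda>t. \<Sum>y\<in>UNIV. of_nat (m y) * bvec u y t)"
      using fun_cong[OF m] by (simp add: fun_eq_iff k algebra_simps sum.distrib sum_distrib_left)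
    with pos_not_neg_modulo[OF assms(1) \<beta> ne] show False by blast
  qed
qed

lemma pos_Sp: "u \<in> Sp v \<Longrightarrow> pos u = pos v"
proof (induction rule: Sp.induct)
  case Sp_refl
  show ?case ..
next
  case (Sp_step u x)
  have u: "u \<in> Sk v" by (rule Sp_subset_Sk[OF Sp_step.hyps(1)])
  have r: "reflexion x (reflexion x u) = u" by (rule reflexion_reflexion[OF Sk_rd[OF u]])
  \<comment> \<open>The reverse inclusion is the same lemma for the reflexion leading back to
    \<open>u\<close>.\<close>
  have "pos (reflexion x u) \<subseteq> pos (reflexion x (reflexion x u))"
    using Sp_step.hyps by (intro pos_isotropic_subset Sk.Sk_step u reflectable_reflexion Sk_rd)
      (simp_all add: cartan_reflexion_diag[OF Sk_rd[OF u]])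
  with pos_isotropic_subset[OF u Sp_step.hyps(2,3)] Sp_step.IH show ?case
    by (simp add: r)
qed

section \<open>Principal reflections\<close>

lemma P_cases:
  assumes "\<alpha> \<in> P"
  obtains u x where "u \<in> Sp v" "\<alpha> = bvec u x"
  using assms unfolding principal_roots_def by blast

lemma P_subset_D: "\<alpha> \<in> P \<Longrightarrow> \<alpha> \<in> D"
  by (simp add: principal_roots_def)

lemma P_subset_pos:
  assumes "\<alpha> \<in> P"
  shows "\<alpha> \<in> pos v"
proof -
  obtain u x where u: "u \<in> Sp v" "\<alpha> = bvec u x"
    using assms by (rule P_cases)
  have "\<alpha> = (\<lambda>t. \<Sum>y\<in>UNIV. of_nat (of_bool (y = x)) * bvec u y t)"
    using single[of 1 x u] u(2) by simp
  then have "\<alpha> \<in> pos u" using P_subset_D[OF assms] unfolding pos_iff by (blast intro: exI[of _ "\<lambda>y. of_bool (y = x)"])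
  with pos_Sp[OF u(1)] show ?thesis by simp
qed

text \<open>At a spine vertex \<open>u\<close> with \<open>\<alpha> = b_u(x)\<close> the reflection
  subtracts a multiple of \<open>b_u(x)\<close> from \<open>\<beta>\<close>, so
  \<open>pos_not_neg_modulo\<close> excludes a negative result; \<open>pos u = pos v\<close>
  transfers this to \<open>v\<close>.\<close>

lemma principal_refl_pos:
  assumes "\<alpha> \<in> P" "\<beta> \<in> pos v" "\<beta> \<noteq> \<alpha>"
  shows "\<beta> \<circ> rho \<alpha> \<in> pos v"
proof (rule ccontr)
  assume contr: "\<beta> \<circ> rho \<alpha> \<notin> pos v"
  obtain u x where u: "u \<in> Sp v" "\<alpha> = bvec u x"
    using assms(1) by (rule P_cases)
  note uS = Sp_subset_Sk[OF u(1)] and pu = pos_Sp[OF u(1)]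
  note A = P_subset_D[OF assms(1)]
  have D: "\<beta> \<in> D" using assms(2) by (simp add: pos_iff)
  have "neg (\<beta> \<circ> rho \<alpha>) \<in> pos u"
    using pos_or_neg[OF uS D_comp[OF weyl_auto_refl[OF A] D]] contr pu by simp
  then obtain m where "neg (\<beta> \<circ> rho \<alpha>) = (\<lambda>t. \<Sum>y\<in>UNIV. of_nat (m y) * bvec u y t)"
    by (auto simp: pos_iff)
  then have "(\<lambda>t. - \<beta> t + \<beta> (coroot v \<alpha>) * bvec u x t) = (\<lambda>t. \<Sum>y\<in>UNIV. of_nat (m y) * bvec u y t)"
    unfolding root_comp_refl[OF A D] by (simp add: u(2))
  moreover have "\<beta> \<in> pos u" "\<beta> \<noteq> bvec u x" using assms u pu by auto
  ultimately show False using pos_not_neg_modulo[OF uS] by blast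
qed

section \<open>Generation by principal reflections\<close>

definition refl_prod :: "('h \<Rightarrow> complex) list \<Rightarrow> 'h \<Rightarrow> 'h" where
  "refl_prod \<alpha>s = foldr (\<lambda>\<alpha> g. rho \<alpha> \<circ> g) \<alpha>s id"

lemma refl_prod_simps [simp]:
  "refl_prod [] = id" "refl_prod (\<alpha> # \<alpha>s) = rho \<alpha> \<circ> refl_prod \<alpha>s"
  by (simp_all add: refl_prod_def)

lemma refl_prod_append: "refl_prod (\<alpha>s @ \<beta>s) = refl_prod \<alpha>s \<circ> refl_prod \<beta>s"
  by (induction \<alpha>s) (simp_all add: comp_assoc)

lemma weyl_auto_refl_prod: "set \<alpha>s \<subseteq> P \<Longrightarrow> weyl_auto (refl_prod \<alpha>s)"
  by (induction \<alpha>s) (auto intro: weyl_auto_id weyl_auto_comp weyl_auto_refl P_subset_D)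

lemma inv_refl_prod: "set \<alpha>s \<subseteq> P \<Longrightarrow> inv (refl_prod \<alpha>s) = refl_prod (rev \<alpha>s)"
proof (induction \<alpha>s)
  case Nil
  then show ?case by simp
next
  case (Cons \<alpha> \<alpha>s)
  then have "bij (rho \<alpha>)" "bij (refl_prod \<alpha>s)"
    using weyl_autoD(1)[OF weyl_auto_refl[OF P_subset_D]] weyl_autoD(1)[OF weyl_auto_refl_prod]
    by (auto simp: auto_on_def)
  then have "inv (rho \<alpha> \<circ> refl_prod \<alpha>s) = inv (refl_prod \<alpha>s) \<circ> inv (rho \<alpha>)"
    by (rule o_inv_distrib)
  moreover have "inv (refl_prod \<alpha>s) = refl_prod (rev \<alpha>s)" "inv (rho \<alpha>) = rho \<alpha>"
    using Cons by (simp_all add: inv_refl P_subset_D)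
  ultimately show ?case
    by (simp only: refl_prod_simps rev.simps refl_prod_append comp_id)
qed

text \<open>A further reflexion at \<open>weyl_act w u'\<close> is the image under \<open>w\<close>
  of a reflexion at \<open>u'\<close>. If isotropic, it moves \<open>u'\<close> inside the spine; if
  anisotropic, it is the reflection in a principal root of \<open>u'\<close> and is appended to
  \<open>w\<close> on the right.\<close>

lemma Sk_weyl_orbit:
  "u \<in> Sk v \<Longrightarrow> \<exists>\<alpha>s u'. set \<alpha>s \<subseteq> P \<and> u' \<in> Sp v \<and> u = weyl_act (refl_prod \<alpha>s) u'"
proof (induction rule: Sk.induct)
  case Sk_refl
  have "v = weyl_act (refl_prod []) v" by (simp add: weyl_act_id)
  then show ?case using Sp.Sp_refl by (metis empty_subsetI list.set(1))
next
  case (Sk_step u x)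
  then obtain \<alpha>s u' where *: "set \<alpha>s \<subseteq> P" "u' \<in> Sp v" "u = weyl_act (refl_prod \<alpha>s) u'" by blast
  note u' = Sp_subset_Sk[OF *(2)]
  note w = weyl_autoD(1)[OF weyl_auto_refl_prod[OF *(1)]]
  have wu: "auto_on (hspace u') (refl_prod \<alpha>s)" using w hspace_Sk[OF u'] by simp
  have r: "reflexion x u = weyl_act (refl_prod \<alpha>s) (reflexion x u')"
    using reflexion_weyl_act[OF wu Sk_rd[OF u']] *(3) by simp
  have refl: "reflectable u' x"
    using Sk_step.hyps(2) *(3) by (simp add: reflectable_weyl_act[OF w])
  show ?case
  proof (cases "cartan u' x x = 0")
    case True
    then show ?thesis using r * Sp.Sp_step[OF *(2) refl True] by blast
  next
    case False
    note D = D_memI[OF u' refl False]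
    have "bvec u' x \<in> P" using D *(2) unfolding principal_roots_def by blast
    moreover have "reflexion x u = weyl_act (refl_prod (\<alpha>s @ [bvec u' x])) u'"
      by (simp only: r reflexion_eq_weyl_act[OF u' refl False] weyl_act_comp[OF w auto_on_refl[OF D]]
          refl_prod_append refl_prod_simps comp_id)
    ultimately show ?thesis using * by (metis Un_subset_iff empty_subsetI insert_subset list.simps(15) list.set(1) set_append)
  qed
qed

text \<open>Write the root as the image of a simple root at a spine vertex. That simple root is
  anisotropic by invariance, hence principal, and the reflection is its conjugate; inverting a
  product reverses the word.\<close>

lemma refl_principal_product:
  assumes "\<alpha> \<in> D"
  shows "\<exists>\<alpha>s. set \<alpha>s \<subseteq> P \<and> rho \<alpha> = refl_prod \<alpha>s"
proof -
  obtain u x where u: "u \<in> Sk v" "\<alpha> = bvec u x"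
    using assms by (rule D_cases)
  obtain \<alpha>s u' where *: "set \<alpha>s \<subseteq> P" "u' \<in> Sp v" "u = weyl_act (refl_prod \<alpha>s) u'"
    using Sk_weyl_orbit[OF u(1)] by blast
  note W = weyl_auto_refl_prod[OF *(1)]
  have \<alpha>: "\<alpha> = bvec u' x \<circ> inv (refl_prod \<alpha>s)"
    using u *(3) by (simp add: weyl_act_def)
  have "\<alpha> \<circ> refl_prod \<alpha>s = bvec u' x"
    by (simp add: \<alpha> comp_assoc auto_on_simps[OF weyl_autoD(1)[OF W]])
  then have D: "bvec u' x \<in> D" using D_comp[OF W assms] by simp
  then have P: "bvec u' x \<in> P" using *(2) unfolding principal_roots_def by blast
  have "rho \<alpha> = refl_prod (\<alpha>s @ bvec u' x # rev \<alpha>s)"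
    unfolding \<alpha> refl_conjugate[OF W D]
    by (simp only: refl_prod_append refl_prod_simps inv_refl_prod[OF *(1)] comp_assoc)
  moreover have "set (\<alpha>s @ bvec u' x # rev \<alpha>s) \<subseteq> P" using *(1) P by simp
  ultimately show ?thesis by blast
qed

lemma weyl_group_principal_product:
  "w \<in> weyl_group v \<Longrightarrow> \<exists>\<alpha>s. set \<alpha>s \<subseteq> P \<and> w = refl_prod \<alpha>s"
proof (induction rule: weyl_group.induct)
  case (1 \<alpha>)
  then show ?case by (rule refl_principal_product)
next
  case 2
  show ?case by (rule exI[of _ "[]"]) simp
next
  case (3 w w')
  then obtain \<alpha>s \<beta>s where "set \<alpha>s \<subseteq> P" "w = refl_prod \<alpha>s" "set \<beta>s \<subseteq> P" "w' = refl_prod \<beta>s" by blast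
  then show ?case by (intro exI[of _ "\<alpha>s @ \<beta>s"]) (simp add: refl_prod_append)
next
  case (4 w)
  then obtain \<alpha>s where "set \<alpha>s \<subseteq> P" "w = refl_prod \<alpha>s" by blast
  then show ?case by (intro exI[of _ "rev \<alpha>s"]) (simp add: inv_refl_prod)
qed

text \<open>Read the word from the right and follow \<open>\<alpha>\<close> until it turns negative.
  The letter responsible must be the current image of \<open>\<alpha>\<close>, so its reflection is
  a conjugate of \<open>rho \<alpha>\<close>, and multiplying by \<open>rho \<alpha>\<close> deletes
  that letter.\<close>

lemma exchange:
  assumes "\<alpha> \<in> pos v"
  shows "set \<beta>s \<subseteq> P \<Longrightarrow> \<alpha> \<circ> inv (refl_prod \<beta>s) \<notin> pos v \<Longrightarrow>
    \<exists>\<gamma>s. set \<gamma>s \<subseteq> P \<and> Suc (length \<gamma>s) = length \<beta>s \<and> refl_prod \<gamma>s = refl_prod \<beta>s \<circ> rho \<alpha>"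
proof (induction \<beta>s)
  case Nil
  with assms show ?case by simp
next
  case (Cons \<beta> \<beta>s)
  have D: "\<alpha> \<in> D" using assms by (simp add: pos_iff)
  have \<beta>: "\<beta> \<in> P" and \<beta>s: "set \<beta>s \<subseteq> P" using Cons.prems by auto
  note W = weyl_auto_refl_prod[OF \<beta>s] and \<beta>D = P_subset_D[OF \<beta>]
  note w = auto_on_simps[OF weyl_autoD(1)[OF W]]
  define \<gamma> where "\<gamma> = \<alpha> \<circ> inv (refl_prod \<beta>s)"
  show ?case
  proof (cases "\<gamma> \<in> pos v")
    case False
    then obtain \<gamma>s where *: "set \<gamma>s \<subseteq> P" "Suc (length \<gamma>s) = length \<beta>s"
      "refl_prod \<gamma>s = refl_prod \<beta>s \<circ> rho \<alpha>"
      using Cons.IH[OF \<beta>s False[unfolded \<gamma>_def]] by blast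
    then show ?thesis using \<beta> by (intro exI[of _ "\<beta> # \<gamma>s"]) (simp add: comp_assoc)
  next
    case True
    have "inv (refl_prod (\<beta> # \<beta>s)) = inv (refl_prod \<beta>s) \<circ> rho \<beta>"
      using inv_refl_prod[OF Cons.prems(1)] by (simp add: refl_prod_append inv_refl_prod[OF \<beta>s])
    then have "\<alpha> \<circ> inv (refl_prod (\<beta> # \<beta>s)) = \<gamma> \<circ> rho \<beta>"
      by (simp only: \<gamma>_def comp_assoc)
    with Cons.prems(2) have "\<gamma> \<circ> rho \<beta> \<notin> pos v"
      by (simp only:) simp
    \<comment> \<open>The reflection in \<open>\<beta>\<close> makes no other positive root
      negative.\<close>
    with principal_refl_pos[OF \<beta> True] have "\<gamma> = \<beta>" by blast
    then have "rho \<beta> = refl_prod \<beta>s \<circ> rho \<alpha> \<circ> inv (refl_prod \<beta>s)"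
      using refl_conjugate[OF W D] by (simp add: \<gamma>_def)
    then have "refl_prod (\<beta> # \<beta>s) \<circ> rho \<alpha> = refl_prod \<beta>s \<circ> (rho \<alpha> \<circ> ((inv (refl_prod \<beta>s) \<circ> refl_prod \<beta>s) \<circ> rho \<alpha>))"
      by (simp add: comp_assoc)
    also have "\<dots> = refl_prod \<beta>s"
      by (simp add: w refl_involution[OF D])
    finally have *: "refl_prod \<beta>s = refl_prod (\<beta> # \<beta>s) \<circ> rho \<alpha>" ..
    show ?thesis by (intro exI[of _ \<beta>s] conjI \<beta>s *) simp
  qed
qed

text \<open>For \<open>w\<close> the product of \<open>\<beta>s\<close>, a positive root is an
  inversion when its image under the inverse of \<open>w\<close> is negative. One more reflection in
  \<open>\<alpha>\<close> alters the sign of that image only at \<open>\<alpha>\<close> and its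
  negative; the positive root in question is \<open>w \<alpha>\<close>, which was not an inversion
  before.\<close>

lemma inversions_append:
  assumes "set \<beta>s \<subseteq> P" "\<alpha> \<in> P" "\<alpha> \<circ> inv (refl_prod \<beta>s) \<in> pos v"
  shows "pos v - pos (weyl_act (refl_prod (\<beta>s @ [\<alpha>])) v) =
      insert (\<alpha> \<circ> inv (refl_prod \<beta>s)) (pos v - pos (weyl_act (refl_prod \<beta>s) v))"
    and "\<alpha> \<circ> inv (refl_prod \<beta>s) \<in> pos (weyl_act (refl_prod \<beta>s) v)"
proof -
  let ?w = "refl_prod \<beta>s"
  note A = P_subset_D[OF assms(2)]
  note W = weyl_auto_refl_prod[OF assms(1)]
  note w = auto_on_simps[OF weyl_autoD(1)[OF W]]
  have W': "weyl_auto (?w \<circ> rho \<alpha>)" by (rule weyl_auto_comp[OF W weyl_auto_refl[OF A]])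
  have app: "refl_prod (\<beta>s @ [\<alpha>]) = ?w \<circ> rho \<alpha>" by (simp add: refl_prod_append)
  show "\<alpha> \<circ> inv ?w \<in> pos (weyl_act ?w v)"
    by (simp add: pos_weyl_act[OF W] comp_assoc w P_subset_pos[OF assms(2)])
  have "\<beta> \<circ> (?w \<circ> rho \<alpha>) \<notin> pos v \<longleftrightarrow> \<beta> = \<alpha> \<circ> inv ?w \<or> \<beta> \<circ> ?w \<notin> pos v" if \<beta>: "\<beta> \<in> pos v" for \<beta>
  proof -
    define \<delta> where "\<delta> = \<beta> \<circ> ?w"
    have \<beta>\<delta>: "\<beta> = \<delta> \<circ> inv ?w" by (simp add: \<delta>_def comp_assoc w)
    \<comment> \<open>Otherwise the positive root \<open>\<beta>\<close> would be the negative of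
      the positive root \<open>\<alpha> \<circ> inv ?w\<close>.\<close>
    have "\<delta> \<noteq> neg \<alpha>"
    proof
      assume "\<delta> = neg \<alpha>"
      then have "\<beta> = neg (\<alpha> \<circ> inv ?w)" by (simp add: \<beta>\<delta> fun_eq_iff)
      with pos_not_neg[OF Sk.Sk_refl assms(3)] \<beta> show False by simp
    qed
    have "\<delta> \<circ> rho \<alpha> \<notin> pos v \<longleftrightarrow> \<delta> = \<alpha> \<or> \<delta> \<notin> pos v"
    proof (cases "\<delta> = \<alpha>")
      case True
      then show ?thesis
        using pos_not_neg[OF Sk.Sk_refl P_subset_pos[OF assms(2)]] by (simp add: root_comp_refl_self[OF A])
    next
      case False
      have "\<delta> \<in> pos v" if "\<delta> \<circ> rho \<alpha> \<in> pos v"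
      proof -
        have "\<delta> \<circ> rho \<alpha> \<noteq> \<alpha>"
          using \<open>\<delta> \<noteq> neg \<alpha>\<close> comp_refl_refl[OF A, of \<delta>] root_comp_refl_self[OF A] by metis
        from principal_refl_pos[OF assms(2) that this] show ?thesis
          by (simp add: comp_refl_refl[OF A])
      qed
      with False principal_refl_pos[OF assms(2) _ False] show ?thesis by blast
    qed
    moreover have "\<beta> = \<alpha> \<circ> inv ?w \<longleftrightarrow> \<delta> = \<alpha>"
      by (auto simp: \<delta>_def comp_assoc w)
    ultimately show ?thesis by (simp add: \<delta>_def comp_assoc)
  qed
  then show "pos v - pos (weyl_act (refl_prod (\<beta>s @ [\<alpha>])) v) =
      insert (\<alpha> \<circ> inv ?w) (pos v - pos (weyl_act ?w v))"
    unfolding app set_eq_iff Diff_iff insert_iff pos_weyl_act[OF W] pos_weyl_act[OF W']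
    using assms(3) by blast
qed

text \<open>Prefixes of a shortest word are shortest, and by exchange the last letter cannot have a
  negative image under the prefix, as the word could then be shortened. So every letter adds exactly
  one inversion.\<close>

lemma card_inversions:
  assumes "set \<alpha>s \<subseteq> P"
    and "\<And>\<gamma>s. set \<gamma>s \<subseteq> P \<Longrightarrow> refl_prod \<gamma>s = refl_prod \<alpha>s \<Longrightarrow> length \<alpha>s \<le> length \<gamma>s"
  shows "finite (pos v - pos (weyl_act (refl_prod \<alpha>s) v)) \<and>
    card (pos v - pos (weyl_act (refl_prod \<alpha>s) v)) = length \<alpha>s"
  using assms
proof (induction \<alpha>s rule: rev_induct)
  case Nil
  show ?case unfolding refl_prod_simps weyl_act_id by simp
next
  case (snoc \<alpha> \<beta>s)
  then have \<alpha>: "\<alpha> \<in> P" and \<beta>s: "set \<beta>s \<subseteq> P" by auto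
  have IH: "finite (pos v - pos (weyl_act (refl_prod \<beta>s) v)) \<and>
    card (pos v - pos (weyl_act (refl_prod \<beta>s) v)) = length \<beta>s"
  proof (rule snoc.IH[OF \<beta>s])
    fix \<gamma>s assume "set \<gamma>s \<subseteq> P" "refl_prod \<gamma>s = refl_prod \<beta>s"
    then have "length (\<beta>s @ [\<alpha>]) \<le> length (\<gamma>s @ [\<alpha>])"
      using \<alpha> by (intro snoc.prems(2)) (auto simp: refl_prod_append)
    then show "length \<beta>s \<le> length \<gamma>s" by simp
  qed
  have "\<alpha> \<circ> inv (refl_prod \<beta>s) \<in> pos v"
  proof (rule ccontr)
    assume "\<alpha> \<circ> inv (refl_prod \<beta>s) \<notin> pos v"
    from exchange[OF P_subset_pos[OF \<alpha>] \<beta>s this] obtain \<gamma>s where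
      "set \<gamma>s \<subseteq> P" "Suc (length \<gamma>s) = length \<beta>s" "refl_prod \<gamma>s = refl_prod (\<beta>s @ [\<alpha>])"
      by (auto simp: refl_prod_append)
    with snoc.prems(2)[of \<gamma>s] show False by simp
  qed
  from inversions_append[OF \<beta>s \<alpha> this] IH show ?case by simp
qed

theorem weyl_length_eq_card:
  assumes "w \<in> weyl_group v"
  shows "finite (pos v - pos (weyl_act w v)) \<and> weyl_length v w = card (pos v - pos (weyl_act w v))"
proof -
  let ?Q = "\<lambda>n. \<exists>\<alpha>s. length \<alpha>s = n \<and> set \<alpha>s \<subseteq> P \<and> w = refl_prod \<alpha>s"
  have len: "weyl_length v w = (LEAST n. ?Q n)"
    by (simp add: weyl_length_def refl_prod_def)
  obtain \<alpha>s0 where "set \<alpha>s0 \<subseteq> P" "w = refl_prod \<alpha>s0"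
    using weyl_group_principal_product[OF assms] by blast
  then have "?Q (length \<alpha>s0)" by blast
  then have "?Q (LEAST n. ?Q n)" by (rule LeastI)
  then obtain \<alpha>s where \<alpha>s: "length \<alpha>s = (LEAST n. ?Q n)" "set \<alpha>s \<subseteq> P" "w = refl_prod \<alpha>s" by blast
  have "finite (pos v - pos (weyl_act (refl_prod \<alpha>s) v)) \<and>
    card (pos v - pos (weyl_act (refl_prod \<alpha>s) v)) = length \<alpha>s"
  proof (rule card_inversions[OF \<alpha>s(2)])
    fix \<gamma>s assume "set \<gamma>s \<subseteq> P" "refl_prod \<gamma>s = refl_prod \<alpha>s"
    with \<alpha>s(3) have "?Q (length \<gamma>s)" by auto
    then show "length \<alpha>s \<le> length \<gamma>s" unfolding \<alpha>s(1) by (rule Least_le)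
  qed
  moreover have "weyl_length v w = length \<alpha>s"
    using len \<alpha>s(1) by (rule trans[OF _ sym])
  ultimately show ?thesis by (simp add: \<alpha>s(3))
qed

end

text \<open>Two vertices of the skeleton are joined by an arrow through \<open>v\<close> that acts
  as the identity; admissibility turns it into an isomorphism of the quotients, to which the
  comparison results apply.\<close>

lemma root_skeleton_of_admissible:
  fixes v :: "('h::complex_vector, 'x::finite) root_datum"
  assumes rd: "is_root_datum v" and adm: "admissible (component v)"
  shows "root_skeleton v"
proof -
  obtain I where I: "\<forall>u\<in>component v. superideal u (I u) \<and> (\<forall>h\<in>hspace u. Cartan h \<in> I u \<longrightarrow> h = 0)"
    and iso: "\<forall>u\<in>component v. \<forall>u'\<in>component v. \<forall>\<theta>. arrow u \<theta> u' \<longrightarrow>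
      (\<exists>\<phi>. superalgebra_iso u (I u) u' (I u') \<phi> \<and>
        (\<forall>h\<in>hspace u. quot_eq (I u') (\<phi> (Cartan h)) (Cartan (\<theta> h))))"
    using adm unfolding admissible_def by (elim exE conjE)
  have ideal: "superideal u (I u)" and inj: "h \<in> hspace u \<Longrightarrow> Cartan h \<in> I u \<Longrightarrow> h = 0"
    if "u \<in> component v" for u h
    using I that by simp_all
  have comp: "u \<in> component v" if "u \<in> Sk v" for u
    using arrow_Sk[OF that rd] by (auto simp: component_def)
  have compare: "\<exists>\<phi>. hb_quotient_iso u' u (I u) (I u') \<phi>" if u: "u \<in> Sk v" "u' \<in> Sk v" for u u'
  proof -
    note h = hspace_Sk[OF u(1)] hspace_Sk[OF u(2)]
    \<comment> \<open>The form produced by inverting an arrow and composing; it is the identity on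
      \<open>hspace v\<close>, with unspecified values elsewhere.\<close>
    define \<theta> where "\<theta> = id \<circ> inv_into (hspace v) id"
    have "arrow u' \<theta> u"
      unfolding \<theta>_def by (rule arrow_comp[OF arrow_inv arrow_Sk]) (intro arrow_Sk u rd)+
    then obtain \<phi> where \<phi>: "superalgebra_iso u' (I u') u (I u) \<phi>"
      "\<forall>h\<in>hspace u'. quot_eq (I u) (\<phi> (Cartan h)) (Cartan (\<theta> h))"
      using iso[rule_format, OF comp[OF u(2)] comp[OF u(1)]] by blast
    have "\<theta> h = h" if "h \<in> hspace v" for h
      using inv_into_f_f[of id "hspace v" h] that by (simp add: \<theta>_def)
    then have "hb_quotient_iso u' u (I u) (I u') \<phi>"
      using \<phi> h ideal[OF comp[OF u(1)]] ideal[OF comp[OF u(2)]] inj[OF comp[OF u(1)]]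
        Sk_root_datum[OF u(1) rd] Sk_root_datum[OF u(2) rd]
      by unfold_locales auto
    then show ?thesis by (intro exI)
  qed
  show ?thesis
  proof
    show "is_root_datum v" by (rule rd)
  next
    fix u u' x assume u: "u \<in> Sk v" "u' \<in> Sk v"
    then obtain \<phi> where "hb_quotient_iso u' u (I u) (I u') \<phi>" using compare by blast
    then interpret hb_quotient_iso u' u "I u" "I u'" \<phi> .
    \<comment> \<open>Vanishing off the space upgrades equality on \<open>hspace u\<close> to
      equality of functions.\<close>
    have out: "bvec u' y t = 0" "bvec u y t = 0" if "t \<notin> hspace u" for y t
      using that bvec_outside[OF src.root_datum] bvec_outside[OF root_datum] hspace_eq by auto
    obtain n where "(\<forall>h\<in>hspace u. bvec u' x h = (\<Sum>y\<in>UNIV. of_nat (n y) * bvec u y h)) \<or>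
       (\<forall>h\<in>hspace u. bvec u' x h = - (\<Sum>y\<in>UNIV. of_nat (n y) * bvec u y h))"
      using simple_root_coordinates by blast
    then have "bvec u' x = (\<lambda>t. \<Sum>y\<in>UNIV. of_nat (n y) * bvec u y t) \<or>
          bvec u' x = (\<lambda>t. - (\<Sum>y\<in>UNIV. of_nat (n y) * bvec u y t))"
    proof (elim disjE)
      assume *: "\<forall>h\<in>hspace u. bvec u' x h = (\<Sum>y\<in>UNIV. of_nat (n y) * bvec u y h)"
      have "bvec u' x t = (\<Sum>y\<in>UNIV. of_nat (n y) * bvec u y t)" for t
        using * out[of t] by (cases "t \<in> hspace u") auto
      then show ?thesis by blast
    next
      assume *: "\<forall>h\<in>hspace u. bvec u' x h = - (\<Sum>y\<in>UNIV. of_nat (n y) * bvec u y h)"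
      have "bvec u' x t = - (\<Sum>y\<in>UNIV. of_nat (n y) * bvec u y t)" for t
        using * out[of t] by (cases "t \<in> hspace u") auto
      then show ?thesis by blast
    qed
    then show "\<exists>n. bvec u' x = (\<lambda>t. \<Sum>y\<in>UNIV. of_nat (n y) * bvec u y t) \<or>
          bvec u' x = (\<lambda>t. - (\<Sum>y\<in>UNIV. of_nat (n y) * bvec u y t))" by (intro exI)
  next
    fix u u' x y assume u: "u \<in> Sk v" "u' \<in> Sk v" and eq: "bvec u' x = bvec u y"
    then obtain \<phi> where "hb_quotient_iso u' u (I u) (I u') \<phi>" using compare by blast
    then interpret hb_quotient_iso u' u "I u" "I u'" \<phi> .
    show "\<exists>c. avec u' x = c *\<^sub>C avec u y" by (rule simple_coroot_proportional[OF eq])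
  qed
qed

text \<open>Finiteness is asserted separately because \<open>card\<close> of an infinite set is
  0.\<close>

theorem corollary5p2p8:
  fixes v v' :: "('h::complex_vector, 'x::finite) root_datum"
    and w :: "'h \<Rightarrow> 'h"
  assumes "is_root_datum v"
    and "indecomposable (component v)"
    and "admissible (component v)"
    and "w \<in> weyl_group v"
    and "v' = weyl_act w v"
  shows "finite (positive_anisotropic_roots v v - positive_anisotropic_roots v v') \<and>
         weyl_length v w =
           card (positive_anisotropic_roots v v - positive_anisotropic_roots v v')"
  using root_skeleton.weyl_length_eq_card[OF root_skeleton_of_admissible[OF assms(1,3)] assms(4)]
  by (simp add: assms(5))

end
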